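(* Let $c(r)=2^{\lfloor (r-2)/2\rfloor}+2^{\lceil (r-2)/2\rceil}-r-1$. Let $l_0,m_0$ be integers with $c(l_0)>0$ and $c(m_0)>0$, and let $l,m$ be integers with $l\ge 5$, $m\ge5$, $l\ge l_0$, $m\ge m_0$. Put $$l_1=c(l_0)\binom{l+m-l_0-m_0}{l-l_0}-1,\qquad m_1=c(m_0)\binom{l+m-l_0-m_0}{m-m_0}-1.$$ Then $f(l,m,l_1,m_1)$ does not exist: for every positive integer $N$ there is a set $\mathcal X$ of at least $N$ points in the plane, in general position and with pairwise distinct $x$-coordinates, which contains no $l$-cup with at most $l_1$ points of $\mathcal X$ inside and no $m$-cap with at most $m_1$ points of $\mathcal X$ inside.
   Context: Fix Cartesian coordinates $(x,y)$ in the plane. Let $\mathcal X$ be a finite set of points in general position (no three collinear) with pairwise distinct $x$-coordinates. A subset $\{(x_{1},y_{1}),\dots,(x_{r},y_{r})\}$ with $x_1<\dots<x_r$ is an $r$-cup if the slopes $\frac{y_{j+1}-y_j}{x_{j+1}-x_j}$, $j=1,\dots,r-1$, are strictly increasing in $j$, and an $r$-cap if they are strictly decreasing. The points of $\mathcal X$ inside a cup or cap are the points of $\mathcal X$ lying in the interior of the convex hull of the cup or cap. $f(l,m,l_1,m_1)$ is the least positive integer (if it exists) such that every such set $\mathcal X$ with at least $f(l,m,l_1,m_1)$ points contains an $l$-cup with at most $l_1$ points of $\mathcal X$ inside or an $m$-cap with at most $m_1$ points of $\mathcal X$ inside.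
   Formalization: The integers l_0 and m_0 are taken to be nonnegative; for negative values with c>0 the claim can fail (e.g. l=m=5, l_0=m_0=-100, where f exists by Erdős–Szekeres). *)

theory Defs
  imports "HOL-Analysis.Analysis"
begin

type_synonym point = "real \<times> real"

definition slope :: "point \<Rightarrow> point \<Rightarrow> real" where
  "slope p q = (snd q - snd p) / (fst q - fst p)"

definition admissible :: "point set \<Rightarrow> bool" where
  "admissible X \<longleftrightarrow> finite X \<and>
     (\<forall>p\<in>X. \<forall>q\<in>X. \<forall>r\<in>X. p \<noteq> q \<and> q \<noteq> r \<and> p \<noteq> r \<longrightarrow> \<not> collinear {p, q, r}) \<and>
     (\<forall>p\<in>X. \<forall>q\<in>X. p \<noteq> q \<longrightarrow> fst p \<noteq> fst q)"

definition x_sorted :: "nat \<Rightarrow> point list \<Rightarrow> bool" where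
  "x_sorted r ps \<longleftrightarrow> length ps = r \<and> sorted_wrt (\<lambda>p q. fst p < fst q) ps"

definition is_cup :: "nat \<Rightarrow> point list \<Rightarrow> bool" where
  "is_cup r ps \<longleftrightarrow> x_sorted r ps \<and>
     (\<forall>i j. i < j \<and> j + 1 < r \<longrightarrow> slope (ps ! i) (ps ! (i+1)) < slope (ps ! j) (ps ! (j+1)))"

definition is_cap :: "nat \<Rightarrow> point list \<Rightarrow> bool" where
  "is_cap r ps \<longleftrightarrow> x_sorted r ps \<and>
     (\<forall>i j. i < j \<and> j + 1 < r \<longrightarrow> slope (ps ! i) (ps ! (i+1)) > slope (ps ! j) (ps ! (j+1)))"

definition inside_count :: "point set \<Rightarrow> point list \<Rightarrow> nat" where
  "inside_count X ps = card {p \<in> X. p \<in> interior (convex hull (set ps))}"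

definition cc :: "int \<Rightarrow> real" where
  "cc r = 2 powi \<lfloor>real_of_int (r - 2) / 2\<rfloor> + 2 powi \<lceil>real_of_int (r - 2) / 2\<rceil> - real_of_int r - 1"

end

theory Submission
  imports Defs
begin

text \<open>
  The starting point is a Horton set with the roles of the coordinates exchanged: recursively
  \<open>Y = A \<union> B\<close>, where \<open>B\<close> lies far to the right of \<open>A\<close> and the heights in \<open>A\<close> and \<open>B\<close> interlace. A
  cup (or cap) meeting both halves consists of a monotone arc of \<open>k\<close> points in \<open>A\<close> and one of \<open>j\<close>
  points in \<open>B\<close>. A monotone arc takes at most one point from the far half at each level of the
  recursion, so there are at least \<open>2 ^ (k - 1) - k\<close> points of \<open>A\<close> between the arc in \<open>A\<close> and
  the half \<open>B\<close>, and similarly for \<open>B\<close>. By convexity a cup or cap of \<open>r\<close> points has at least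
  \<open>c(r) + 1\<close> points inside.

  Now replace every point of \<open>Y\<close> by a tiny, almost vertical copy of an Erdos-Szekeres set \<open>Z\<close> of
  size \<open>(l + m - l0 - m0) choose (l - l0)\<close> without cups of \<open>l - l0 + 2\<close> and caps of \<open>m - m0 + 2\<close>
  points. A cup can use several points only of its last cluster, a cap only of its first one, so an
  \<open>l\<close>-cup meets at least \<open>l0\<close> clusters, which form a cup of \<open>Y\<close> and enclose all copies of \<open>Z\<close> at
  the points inside it.
\<close>

section \<open>Orientation of triples\<close>

text \<open>Twice the signed area of the triangle \<open>p q r\<close>, positive for a
  counterclockwise turn. Strict signs of this polynomial survive small perturbations, on which both
  constructions below rest.\<close>

definition ori :: "point \<Rightarrow> point \<Rightarrow> point \<Rightarrow> real" where
  "ori p q r = (fst q - fst p) * (snd r - snd p) - (snd q - snd p) * (fst r - fst p)"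

lemma ori_rotate: "ori q r p = ori p q r"
  unfolding ori_def by algebra

lemma ori_swap: "ori q p r = - ori p q r"
  unfolding ori_def by algebra

lemma collinear_imp_ori_eq_0:
  assumes "collinear {p, q, r}"
  shows "ori p q r = 0"
proof -
  obtain u where u: "\<And>x y. x \<in> {p, q, r} \<Longrightarrow> y \<in> {p, q, r} \<Longrightarrow> \<exists>c. x - y = c *\<^sub>R u"
    using assms unfolding collinear_def by blast
  obtain c d where "q - p = c *\<^sub>R u" "r - p = d *\<^sub>R u"
    using u[of q p] u[of r p] by auto
  then have "fst q - fst p = c * fst u" "snd q - snd p = c * snd u"
      "fst r - fst p = d * fst u" "snd r - snd p = d * snd u"
    by (metis fst_diff fst_scaleR real_scaleR_def, metis snd_diff snd_scaleR real_scaleR_def)+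
  then show ?thesis
    unfolding ori_def by simp
qed

text \<open>The union of the open triangles with corners in \<open>C\<close>. It can be smaller than
  the interior of the hull, but it depends on orientations alone, so it can be followed through the
  inflation, and it suffices for lower bounds on the number of inside points.\<close>

definition enclosed :: "point set \<Rightarrow> point set" where
  "enclosed C = {z. \<exists>p\<in>C. \<exists>q\<in>C. \<exists>r\<in>C. ori p q z > 0 \<and> ori q r z > 0 \<and> ori r p z > 0}"

lemma enclosed_subset_interior: "enclosed C \<subseteq> interior (convex hull C)"
proof
  fix z assume "z \<in> enclosed C"
  then obtain p q r where pqr: "p \<in> C" "q \<in> C" "r \<in> C"
      and z: "ori p q z > 0" "ori q r z > 0" "ori r p z > 0"
    unfolding enclosed_def by blast
  define T where "T = {w. ori p q w > 0 \<and> ori q r w > 0 \<and> ori r p w > 0}"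
  have "open T"
    unfolding T_def ori_def
    by (intro open_Collect_conj open_Collect_less continuous_intros)
  moreover have "T \<subseteq> convex hull C"
  proof
    fix w assume w: "w \<in> T"
    \<comment> \<open>The three partial areas add up to the area of \<open>p q r\<close>, so
      dividing them by \<open>s\<close> gives the barycentric coordinates of
      \<open>w\<close>.\<close>
    define s where "s = ori p q w + ori q r w + ori r p w"
    have s: "s > 0" "s = ori p q r"
      using w unfolding s_def T_def ori_def by (auto simp: algebra_simps)
    define a b c where "a = ori q r w / s" and "b = ori r p w / s" and "c = ori p q w / s"
    have "a \<ge> 0" "b \<ge> 0" "c \<ge> 0"
      using w s(1) unfolding a_def b_def c_def T_def by auto
    moreover have "a + b + c = 1"
      using s(1) unfolding a_def b_def c_def s_def by (simp add: divide_simps)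
    moreover have "w = a *\<^sub>R p + b *\<^sub>R q + c *\<^sub>R r"
    proof (rule prod_eqI)
      have "s * fst w = ori q r w * fst p + ori r p w * fst q + ori p q w * fst r"
        unfolding s(2) ori_def by algebra
      then show "fst w = fst (a *\<^sub>R p + b *\<^sub>R q + c *\<^sub>R r)"
        using s(1) unfolding a_def b_def c_def by (simp add: field_simps)
      have "s * snd w = ori q r w * snd p + ori r p w * snd q + ori p q w * snd r"
        unfolding s(2) ori_def by algebra
      then show "snd w = snd (a *\<^sub>R p + b *\<^sub>R q + c *\<^sub>R r)"
        using s(1) unfolding a_def b_def c_def by (simp add: field_simps)
    qed
    ultimately have "w \<in> convex hull {p, q, r}"
      unfolding convex_hull_3 by blast
    then show "w \<in> convex hull C"
      using hull_mono[of "{p, q, r}" C convex] pqr by blast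
  qed
  moreover have "z \<in> T"
    using z by (simp add: T_def)
  ultimately show "z \<in> interior (convex hull C)"
    using interior_maximal by blast
qed

text \<open>Cups are the sets with \<open>bends 1\<close>, caps those with \<open>bends (- 1)\<close>.\<close>

definition bends :: "real \<Rightarrow> point set \<Rightarrow> bool" where
  "bends t C \<longleftrightarrow> (\<forall>p\<in>C. \<forall>q\<in>C. \<forall>r\<in>C. fst p < fst q \<longrightarrow> fst q < fst r \<longrightarrow> t * ori p q r > 0)"

lemma bendsD:
  "bends t C \<Longrightarrow> p \<in> C \<Longrightarrow> q \<in> C \<Longrightarrow> r \<in> C \<Longrightarrow> fst p < fst q \<Longrightarrow> fst q < fst r \<Longrightarrow> t * ori p q r > 0"
  unfolding bends_def by blast

section \<open>From slopes of consecutive points to orientations of triples\<close>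

lemma rise_le:
  fixes x y :: "nat \<Rightarrow> real"
  assumes "i \<le> j" and "\<And>n. i \<le> n \<Longrightarrow> n < j \<Longrightarrow> y (Suc n) - y n \<le> s * (x (Suc n) - x n)"
  shows "y j - y i \<le> s * (x j - x i)"
  using assms
proof (induction j rule: dec_induct)
  case base
  then show ?case by simp
next
  case (step n)
  have "y n - y i \<le> s * (x n - x i)"
    using step by auto
  moreover have "y (Suc n) - y n \<le> s * (x (Suc n) - x n)"
    using step by auto
  ultimately show ?case
    by (simp add: algebra_simps)
qed

text \<open>Cups and caps are defined by consecutive slopes only. After multiplying heights by
  \<open>t\<close>, which turns caps into cups for \<open>t = - 1\<close>, the chord from
  \<open>i\<close> to \<open>j\<close> has slope at most that of the step ending at
  \<open>j\<close>, and the chord from \<open>j\<close> to \<open>k\<close> at least that of the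
  step leaving \<open>j\<close>.\<close>

lemma monotone_slopes_bends:
  assumes sorted: "x_sorted r ps"
    and slopes: "\<And>i j. i < j \<Longrightarrow> j + 1 < r \<Longrightarrow>
      t * slope (ps ! i) (ps ! (i+1)) < t * slope (ps ! j) (ps ! (j+1))"
  shows "bends t (set ps)" and "card (set ps) = r"
proof -
  have len: "length ps = r"
    and less: "\<And>i j. i < j \<Longrightarrow> j < r \<Longrightarrow> fst (ps ! i) < fst (ps ! j)"
    using sorted unfolding x_sorted_def by (auto simp: sorted_wrt_iff_nth_less)
  have "distinct ps"
    unfolding distinct_conv_nth len by (metis less less_irrefl linorder_neqE_nat)
  then show "card (set ps) = r"
    using len distinct_card by blast
  define x y where "x = (\<lambda>n. fst (ps ! n))" and "y = (\<lambda>n. t * snd (ps ! n))"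
  define s where "s = (\<lambda>n. t * slope (ps ! n) (ps ! (n + 1)))"
  have step: "y (Suc n) - y n = s n * (x (Suc n) - x n)" if "Suc n < r" for n
    using less[of n "Suc n"] that unfolding x_def y_def s_def slope_def
    by (simp add: right_diff_distrib[symmetric])
  have xless: "x i < x j" if "i < j" "j < r" for i j
    using less that by (simp add: x_def)
  have triple: "t * ori (ps ! i) (ps ! j) (ps ! k) > 0" if ijk: "i < j" "j < k" "k < r" for i j k
  proof -
    have sle: "s m \<le> s n" if "m \<le> n" "n + 1 < r" for m n
      using slopes[of m n] that unfolding s_def by (cases "m = n") auto
    have left: "y j - y i \<le> s (j - 1) * (x j - x i)"
    proof (rule rise_le)
      show "i \<le> j" using ijk by simp
      fix n assume n: "i \<le> n" "n < j"
      have "s n * (x (Suc n) - x n) \<le> s (j - 1) * (x (Suc n) - x n)"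
        using n ijk xless[of n "Suc n"] by (intro mult_right_mono sle) auto
      then show "y (Suc n) - y n \<le> s (j - 1) * (x (Suc n) - x n)"
        using step[of n] n ijk by simp
    qed
    have "- y k - (- y j) \<le> (- s j) * (x k - x j)"
    proof (rule rise_le[where y = "\<lambda>n. - y n"])
      show "j \<le> k" using ijk by simp
      fix n assume n: "j \<le> n" "n < k"
      have "s j * (x (Suc n) - x n) \<le> s n * (x (Suc n) - x n)"
        using n ijk xless[of n "Suc n"] by (intro mult_right_mono sle) auto
      then show "- y (Suc n) - - y n \<le> - s j * (x (Suc n) - x n)"
        using step[of n] n ijk by simp
    qed
    then have right: "s j * (x k - x j) \<le> y k - y j"
      by simp
    have xs: "x i < x j" "x j < x k"
      using xless ijk by auto
    have "s (j - 1) < s j"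
      using slopes[of "j - 1" j] ijk unfolding s_def by simp
    then have "s (j - 1) * ((x j - x i) * (x k - x j)) < s j * ((x j - x i) * (x k - x j))"
      using xs by (intro mult_strict_right_mono) auto
    moreover have "(y j - y i) * (x k - x j) \<le> s (j - 1) * (x j - x i) * (x k - x j)"
      using left xs by (intro mult_right_mono) auto
    moreover have "s j * (x k - x j) * (x j - x i) \<le> (y k - y j) * (x j - x i)"
      using right xs by (intro mult_right_mono) auto
    ultimately have "0 < (x j - x i) * (y k - y j) - (y j - y i) * (x k - x j)"
      by (simp add: mult_ac)
    also have "\<dots> = t * ori (ps ! i) (ps ! j) (ps ! k)"
      unfolding x_def y_def ori_def by algebra
    finally show ?thesis .
  qed
  show "bends t (set ps)"
    unfolding bends_def
  proof (intro ballI impI)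
    fix p q u assume "p \<in> set ps" "q \<in> set ps" "u \<in> set ps"
    then obtain i j k where ijk: "p = ps ! i" "q = ps ! j" "u = ps ! k" "i < r" "j < r" "k < r"
      by (metis in_set_conv_nth len)
    assume "fst p < fst q" "fst q < fst u"
    then have "i < j" "j < k"
      using less ijk by (metis less_asym linorder_neqE_nat less_irrefl)+
    then show "t * ori p q u > 0"
      using triple ijk by simp
  qed
qed

lemma is_cup_bends:
  assumes "is_cup r ps"
  shows "bends 1 (set ps)" "card (set ps) = r"
  using monotone_slopes_bends[of r ps 1] assms unfolding is_cup_def by auto

lemma is_cap_bends:
  assumes "is_cap r ps"
  shows "bends (- 1) (set ps)" "card (set ps) = r"
  using monotone_slopes_bends[of r ps "- 1"] assms unfolding is_cap_def by auto

section \<open>Horton sets\<close>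

text \<open>For \<open>s = 1\<close> the set \<open>B\<close> lies so far to the right of \<open>A\<close> that, seen from the other set, each
  set looks like a subset of a vertical line; moreover the heights in \<open>A\<close> and \<open>B\<close> interlace.
  The sign makes the notion symmetric: \<open>facing s A B\<close> iff \<open>facing (- s) B A\<close>.\<close>

definition facing :: "real \<Rightarrow> point set \<Rightarrow> point set \<Rightarrow> bool" where
  "facing s A B \<longleftrightarrow>
     (\<forall>a\<in>A. \<forall>a'\<in>A. \<forall>b\<in>B. snd a < snd a' \<longrightarrow> s * ori a a' b < 0) \<and>
     (\<forall>b\<in>B. \<forall>b'\<in>B. \<forall>a\<in>A. snd b < snd b' \<longrightarrow> s * ori b b' a > 0) \<and>
     (\<forall>a\<in>A. \<forall>b\<in>B. snd a \<noteq> snd b \<and> s * fst a < s * fst b) \<and>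
     (\<forall>a\<in>A. \<forall>a'\<in>A. snd a < snd a' \<longrightarrow> (\<exists>b\<in>B. snd a < snd b \<and> snd b < snd a')) \<and>
     (\<forall>b\<in>B. \<forall>b'\<in>B. snd b < snd b' \<longrightarrow> (\<exists>a\<in>A. snd b < snd a \<and> snd a < snd b'))"

lemma facing_sym: "facing s A B \<Longrightarrow> facing (- s) B A"
  unfolding facing_def
  by (elim conjE, intro conjI ballI impI) (simp, simp, metis, simp, blast, blast)

lemma facingD:
  assumes "facing s A B"
  shows "a \<in> A \<Longrightarrow> a' \<in> A \<Longrightarrow> b \<in> B \<Longrightarrow> snd a < snd a' \<Longrightarrow> s * ori a a' b < 0"
    and "b \<in> B \<Longrightarrow> b' \<in> B \<Longrightarrow> a \<in> A \<Longrightarrow> snd b < snd b' \<Longrightarrow> s * ori b b' a > 0"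
    and "a \<in> A \<Longrightarrow> b \<in> B \<Longrightarrow> snd a \<noteq> snd b"
    and "a \<in> A \<Longrightarrow> b \<in> B \<Longrightarrow> s * fst a < s * fst b"
    and "a \<in> A \<Longrightarrow> a' \<in> A \<Longrightarrow> snd a < snd a' \<Longrightarrow> \<exists>b\<in>B. snd a < snd b \<and> snd b < snd a'"
  using assms unfolding facing_def by (simp, simp, simp, simp, simp)

inductive horton :: "point set \<Rightarrow> bool" where
  single: "horton {p}"
| join: "horton A \<Longrightarrow> horton B \<Longrightarrow> facing 1 A B \<Longrightarrow> horton (A \<union> B)"

lemma horton_finite: "horton S \<Longrightarrow> finite S"
  by (induction rule: horton.induct) auto

lemma horton_inj_snd: "horton S \<Longrightarrow> inj_on snd S"
proof (induction rule: horton.induct)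
  case (join A B)
  have "snd a \<noteq> snd b" if "a \<in> A" "b \<in> B" for a b
    using facingD(3)[OF join.hyps(3)] that by blast
  then show ?case
    using join.IH unfolding inj_on_def by (metis Un_iff)
qed auto

lemma horton_inj_fst: "horton S \<Longrightarrow> inj_on fst S"
proof (induction rule: horton.induct)
  case (join A B)
  have "fst a < fst b" if "a \<in> A" "b \<in> B" for a b
    using facingD(4)[OF join.hyps(3)] that by simp
  then show ?case
    using join.IH unfolding inj_on_def by (metis Un_iff less_irrefl)
qed auto

lemma facing_ori_nz:
  assumes "facing s A B" "inj_on snd A" "a \<in> A" "a' \<in> A" "b \<in> B" "a \<noteq> a'"
  shows "ori a a' b \<noteq> 0"
proof -
  have "snd a \<noteq> snd a'"
    using assms by (auto dest: inj_onD)
  then have "s * ori a a' b < 0 \<or> s * ori a' a b < 0"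
    using facingD(1)[OF assms(1), of a a' b] facingD(1)[OF assms(1), of a' a b] assms
    by (meson linorder_neqE)
  then show ?thesis
    using ori_swap[of a a' b] by auto
qed

lemma horton_ori_nz:
  "horton S \<Longrightarrow> p \<in> S \<Longrightarrow> q \<in> S \<Longrightarrow> r \<in> S \<Longrightarrow> p \<noteq> q \<Longrightarrow> q \<noteq> r \<Longrightarrow> p \<noteq> r \<Longrightarrow> ori p q r \<noteq> 0"
proof (induction arbitrary: p q r rule: horton.induct)
  case (join A B)
  have A: "ori a a' b \<noteq> 0" if "a \<noteq> a'" "a \<in> A \<and> a' \<in> A \<and> b \<in> B" for a a' b
    using facing_ori_nz[OF join.hyps(3) horton_inj_snd[OF join.hyps(1)]] that by simp
  have B: "ori a a' b \<noteq> 0" if "a \<noteq> a'" "a \<in> B \<and> a' \<in> B \<and> b \<in> A" for a a' b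
    using facing_ori_nz[OF facing_sym[OF join.hyps(3)] horton_inj_snd[OF join.hyps(2)]] that by simp
  note two = A B
  \<comment> \<open>Two of the three points share a half; a cyclic rotation, which leaves
    \<open>ori\<close> unchanged, moves the third one to the end.\<close>
  consider "p \<in> A \<and> q \<in> A \<and> r \<in> A \<or> p \<in> B \<and> q \<in> B \<and> r \<in> B"
    | "p \<in> A \<and> q \<in> A \<and> r \<in> B \<or> p \<in> B \<and> q \<in> B \<and> r \<in> A"
    | "q \<in> A \<and> r \<in> A \<and> p \<in> B \<or> q \<in> B \<and> r \<in> B \<and> p \<in> A"
    | "r \<in> A \<and> p \<in> A \<and> q \<in> B \<or> r \<in> B \<and> p \<in> B \<and> q \<in> A"
    using join.prems(1-3) by blast
  then show ?case
  proof cases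
    case 1
    then show ?thesis using join.IH join.prems(4-6) by blast
  next
    case 2
    then show ?thesis using two join.prems(4) by blast
  next
    case 3
    then show ?thesis using two[of q r p] join.prems(5) ori_rotate[of q r p] by (elim disjE) simp_all
  next
    case 4
    then show ?thesis using two[of r p q] join.prems(6) ori_rotate[of p q r] by (elim disjE) simp_all
  qed
qed auto

section \<open>Arcs and the points they shade\<close>

text \<open>Each of the \<open>card T - 1\<close> gaps between consecutive heights of
  \<open>T\<close> holds a point of \<open>F\<close>. The induction adds the points of
  \<open>T\<close> from bottom to top, so a new top point opens a gap above everything counted
  before.\<close>

lemma interlaced_card:
  fixes T F :: "point set"
  assumes "finite T" "finite F"
    and gap: "\<And>a a'. a \<in> T \<Longrightarrow> a' \<in> T \<Longrightarrow> snd a < snd a' \<Longrightarrow> \<exists>b\<in>F. snd a < snd b \<and> snd b < snd a'"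
    and "inj_on snd T"
  shows "card T \<le> card {z\<in>F. \<exists>a\<in>T. \<exists>a'\<in>T. snd a < snd z \<and> snd z < snd a'} + 1"
  using assms(1,3,4)
proof (induction T rule: finite_ranking_induct[where f = snd])
  case empty
  then show ?case by simp
next
  case (insert x T)
  let ?G = "\<lambda>T. {z\<in>F. \<exists>a\<in>T. \<exists>a'\<in>T. snd a < snd z \<and> snd z < snd a'}"
  have IH: "card T \<le> card (?G T) + 1"
    using insert by (auto simp: inj_on_def)
  show ?case
  proof (cases "T = {} \<or> x \<in> T")
    case True
    then show ?thesis
    proof
      assume "x \<in> T"
      then show ?thesis
        using IH by (simp only: insert_absorb)
    qed simp
  next
    case False
    then have "T \<noteq> {}" "x \<notin> T" by auto
    have "Max (snd ` T) \<in> snd ` T"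
      using insert(1) \<open>T \<noteq> {}\<close> by (intro Max_in) auto
    then obtain m where m: "m \<in> T" "snd m = Max (snd ` T)"
      by auto
    then have max: "snd y \<le> snd m" if "y \<in> T" for y
      using insert(1) that by simp
    have "snd m \<noteq> snd x"
      using inj_onD[OF insert(5), of m x] m \<open>x \<notin> T\<close> by auto
    then have "snd m < snd x"
      using insert(2)[of m] m by simp
    then obtain b where b: "b \<in> F" "snd m < snd b" "snd b < snd x"
      using insert(4)[of m x] m by auto
    have "b \<notin> ?G T"
      using b max by force
    moreover have "insert b (?G T) \<subseteq> ?G (insert x T)"
      using b m(1) by auto
    moreover have "finite (?G (insert x T))" "finite (?G T)"
      using assms(2) by auto
    ultimately have "card (?G T) + 1 \<le> card (?G (insert x T))"
      using card_mono[of "?G (insert x T)" "insert b (?G T)"] by simp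
    moreover have "card (insert x T) = card T + 1"
      using \<open>x \<notin> T\<close> insert(1) by simp
    ultimately show ?thesis
      using IH by linarith
  qed
qed

text \<open>For \<open>s = 1\<close> an arc is a monotone convex chain bulging to the left; the points of
  \<open>shade s S C\<close> are those visible from the right inside the arc.\<close>

definition arc :: "real \<Rightarrow> point set \<Rightarrow> bool" where
  "arc s C \<longleftrightarrow>
     ((\<forall>p\<in>C. \<forall>q\<in>C. fst p < fst q \<longrightarrow> snd p < snd q) \<or> (\<forall>p\<in>C. \<forall>q\<in>C. fst p < fst q \<longrightarrow> snd q < snd p)) \<and>
     (\<forall>a\<in>C. \<forall>b\<in>C. \<forall>c\<in>C. snd a < snd b \<longrightarrow> snd b < snd c \<longrightarrow> s * ori a b c < 0)"

definition strip :: "point set \<Rightarrow> point set \<Rightarrow> point set" where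
  "strip S C = {z\<in>S. \<exists>a\<in>C. \<exists>a'\<in>C. snd a \<le> snd z \<and> snd z \<le> snd a'}"

definition shade :: "real \<Rightarrow> point set \<Rightarrow> point set \<Rightarrow> point set" where
  "shade s S C = {z\<in>S. \<exists>a\<in>C. \<exists>a'\<in>C. snd a' < snd z \<and> snd z < snd a \<and> s * ori a a' z > 0}"

lemma arc_subset: "arc s D \<Longrightarrow> C \<subseteq> D \<Longrightarrow> arc s C"
  unfolding arc_def by blast

text \<open>The shade bound is the goal, the strip bound makes it inductive: interlacing turns the
  points in the strip of one half into shaded points of the other half. Adding \<open>card C\<close>
  on the right avoids truncated subtraction.\<close>

definition rich :: "real \<Rightarrow> point set \<Rightarrow> bool" where
  "rich s S \<longleftrightarrow> (\<forall>C. C \<subseteq> S \<longrightarrow> C \<noteq> {} \<longrightarrow> arc s C \<longrightarrow>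
     2 ^ (card C - 1) \<le> card (strip S C) \<and> 2 ^ (card C - 1) \<le> card (shade s S C) + card C)"

lemma rich_mono:
  assumes "rich s S" "S \<subseteq> S'" "finite S'" "C \<subseteq> S" "C \<noteq> {}" "arc s C"
  shows "2 ^ (card C - 1) \<le> card (strip S' C) \<and> 2 ^ (card C - 1) \<le> card (shade s S' C) + card C"
proof -
  have "card (strip S C) \<le> card (strip S' C)" "card (shade s S C) \<le> card (shade s S' C)"
    using assms(2,3) unfolding strip_def shade_def by (auto intro!: card_mono)
  moreover have "2 ^ (card C - 1) \<le> card (strip S C) \<and> 2 ^ (card C - 1) \<le> card (shade s S C) + card C"
    using assms unfolding rich_def by blast
  ultimately show ?thesis
    by linarith
qed

text \<open>An arc meeting both halves has a single point in the far one, so the arc loses one point in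
  each halving, whereas the number of points in its strip doubles.\<close>

lemma rich_join:
  assumes f: "facing s N F" and N: "rich s N" "finite N" "inj_on snd N"
    and F: "rich s F" "finite F" "inj_on snd F" and s: "s = 1 \<or> s = - 1"
  shows "rich s (N \<union> F)"
  unfolding rich_def
proof (intro allI impI)
  fix C assume C: "C \<subseteq> N \<union> F" "C \<noteq> {}" and arc: "arc s C"
  let ?P = "2 ^ (card C - 1) \<le> card (strip (N \<union> F) C) \<and>
        2 ^ (card C - 1) \<le> card (shade s (N \<union> F) C) + card C"
  have fin: "finite (N \<union> F)"
    using N F by simp
  define D where "D = C \<inter> N"
  consider "C \<subseteq> N" | "C \<subseteq> F" | a b where "a \<in> C" "a \<in> N" "b \<in> C" "b \<in> F"
    using C by blast
  then show ?P
  proof cases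
    case 1
    then show ?thesis using rich_mono[OF N(1) _ fin] C arc by blast
  next
    case 2
    then show ?thesis using rich_mono[OF F(1) _ fin] C arc by blast
  next
    case (3 a0 b)
    have sep: "(\<forall>a\<in>C \<inter> N. \<forall>b\<in>C \<inter> F. snd a < snd b) \<or> (\<forall>a\<in>C \<inter> N. \<forall>b\<in>C \<inter> F. snd b < snd a)"
    proof -
      have "(\<forall>a\<in>C \<inter> N. \<forall>b\<in>C \<inter> F. fst a < fst b) \<or> (\<forall>a\<in>C \<inter> N. \<forall>b\<in>C \<inter> F. fst b < fst a)"
        using s facingD(4)[OF f] by auto
      moreover have "(\<forall>p\<in>C. \<forall>q\<in>C. fst p < fst q \<longrightarrow> snd p < snd q) \<or>
          (\<forall>p\<in>C. \<forall>q\<in>C. fst p < fst q \<longrightarrow> snd q < snd p)"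
        using arc unfolding arc_def by blast
      ultimately show ?thesis
        by blast
    qed
    \<comment> \<open>By \<open>sep\<close>, \<open>a0\<close> lies above or below any two points of
      \<open>C \<inter> F\<close>, so the arc condition applies to the three in order of height. It
      demands the opposite turn to the one that \<open>facing\<close> gives.\<close>
    have "b' = b" if b': "b' \<in> C \<inter> F" for b'
    proof -
      have "\<not> snd c < snd c'" if c: "c \<in> C \<inter> F" "c' \<in> C \<inter> F" for c c'
      proof
        assume less: "snd c < snd c'"
        then have "s * ori c c' a0 > 0"
          using facingD(2)[OF f] c 3 by blast
        moreover have "s * ori a0 c c' < 0 \<or> s * ori c c' a0 < 0"
          using arc sep less c 3 unfolding arc_def by blast
        ultimately show False
          using ori_rotate[of c c' a0] by simp
      qed
      then have "snd b' = snd b"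
        using b' 3 by (metis IntI linorder_neqE)
      then show ?thesis
        using F(3) b' 3 by (auto dest: inj_onD)
    qed
    then have "C \<inter> F = {b}"
      using 3 by blast
    then have CD: "C = insert b D" and bD: "b \<notin> D"
      using C facingD(3)[OF f, of b b] unfolding D_def by blast+
    have D: "D \<subseteq> N" "D \<noteq> {}" "finite D"
      using 3 N(2) unfolding D_def by auto
    then have k: "card C = card D + 1" "card D \<ge> 1"
      using CD bD by (auto simp: Suc_le_eq card_gt_0_iff)
    define m where "m = (2::nat) ^ (card D - 1)"
    have m: "2 ^ (card C - 1) = 2 * m"
      using k unfolding m_def by (cases "card D") auto
    have IH: "m \<le> card (strip N D)" "m \<le> card (shade s N D) + card D"
      using N(1) D arc_subset[OF arc, of D] CD unfolding rich_def m_def by auto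
    \<comment> \<open>The points of the far half at heights between those of \<open>D\<close>.
      Interlacing forces almost as many of them as there are points in the strip of
      \<open>D\<close>. All of them are shaded, since a line through two points of \<open>N\<close>
      has all of \<open>F\<close> on the side away from the bulge.\<close>
    define G where "G = {z\<in>F. \<exists>a\<in>D. \<exists>a'\<in>D. snd a < snd z \<and> snd z < snd a'}"
    have "card (strip N D) \<le> card {z\<in>F. \<exists>a\<in>strip N D. \<exists>a'\<in>strip N D. snd a < snd z \<and> snd z < snd a'} + 1"
      using N F facingD(5)[OF f] by (intro interlaced_card) (auto simp: strip_def inj_on_def)
    also have "{z\<in>F. \<exists>a\<in>strip N D. \<exists>a'\<in>strip N D. snd a < snd z \<and> snd z < snd a'} \<subseteq> G"
    proof
      fix z assume z: "z \<in> {z\<in>F. \<exists>a\<in>strip N D. \<exists>a'\<in>strip N D. snd a < snd z \<and> snd z < snd a'}"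
      then obtain a a' where "a \<in> strip N D" "a' \<in> strip N D" "snd a < snd z" "snd z < snd a'"
        by blast
      then obtain d d' where "d \<in> D" "d' \<in> D" "snd d < snd z" "snd z < snd d'"
        unfolding strip_def by (blast intro: le_less_trans less_le_trans)
      then show "z \<in> G"
        using z unfolding G_def by blast
    qed
    then have "card {z\<in>F. \<exists>a\<in>strip N D. \<exists>a'\<in>strip N D. snd a < snd z \<and> snd z < snd a'} \<le> card G"
      using F(2) by (intro card_mono) (auto simp: G_def)
    finally have G: "card (strip N D) \<le> card G + 1"
      by simp
    have disj: "N \<inter> F = {}"
      using facingD(3)[OF f] by blast
    have finG: "finite G" "G \<subseteq> F"
      using F(2) unfolding G_def by auto
    have "b \<notin> G"
    proof
      assume "b \<in> G"
      then obtain a a' where "a \<in> D" "a' \<in> D" "snd a < snd b" "snd b < snd a'"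
        unfolding G_def by blast
      then show False
        using sep 3 unfolding D_def by (metis IntI less_asym)
    qed
    \<comment> \<open>\<open>G\<close> is only known to have \<open>m - 1\<close> points. The
      missing one is \<open>b\<close>: here as an element of the strip, in the shade count below
      through \<open>card C = card D + 1\<close>.\<close>
    have "strip N D \<union> insert b G \<subseteq> strip (N \<union> F) C"
    proof -
      have "strip N D \<subseteq> strip (N \<union> F) C" "b \<in> strip (N \<union> F) C"
        using CD 3 unfolding strip_def by blast+
      moreover have "G \<subseteq> strip (N \<union> F) C"
        using CD less_imp_le unfolding strip_def G_def by blast
      ultimately show ?thesis
        by blast
    qed
    then have "card (strip N D \<union> insert b G) \<le> card (strip (N \<union> F) C)"
      using fin by (intro card_mono) (auto simp: strip_def)
    moreover have "card (strip N D \<union> insert b G) = card (strip N D) + (card G + 1)"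
      using finG \<open>b \<notin> G\<close> N(2) disj 3
      by (subst card_Un_disjoint) (auto simp: strip_def)
    ultimately have 1: "2 * m \<le> card (strip (N \<union> F) C)"
      using IH G by linarith
    have "z \<in> shade s (N \<union> F) C" if z: "z \<in> G" for z
    proof -
      obtain a a' where a: "a \<in> D" "a' \<in> D" "snd a < snd z" "snd z < snd a'"
        using z unfolding G_def by auto
      then have "s * ori a a' z < 0"
        using facingD(1)[OF f, of a a' z] D z finG by auto
      then have "s * ori a' a z > 0"
        using ori_swap[of a a' z] by simp
      then show ?thesis
        using a z finG CD unfolding shade_def by auto
    qed
    moreover have "shade s N D \<subseteq> shade s (N \<union> F) C"
      using CD unfolding shade_def by blast
    ultimately have "card (shade s N D \<union> G) \<le> card (shade s (N \<union> F) C)"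
      using fin by (intro card_mono) (auto simp: shade_def)
    moreover have "card (shade s N D \<union> G) = card (shade s N D) + card G"
      using finG N(2) disj by (subst card_Un_disjoint) (auto simp: shade_def)
    ultimately have "2 * m \<le> card (shade s (N \<union> F) C) + card C"
      using IH G k by linarith
    with 1 m show ?P
      by simp
  qed
qed

text \<open>Both signs are required: in a join, the left half is looked at from the right and the
  right half from the left. For \<open>s = - 1\<close> the halves exchange roles by
  \<open>facing_sym\<close>.\<close>

lemma horton_rich:
  "horton S \<Longrightarrow> s = 1 \<or> s = - 1 \<Longrightarrow> rich s S"
proof (induction rule: horton.induct)
  case (single p)
  show ?case
    unfolding rich_def
  proof (intro allI impI)
    fix C assume "C \<subseteq> {p}" "C \<noteq> {}"
    then have "C = {p}"
      by blast
    moreover have "strip {p} {p} = {p}"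
      by (auto simp: strip_def)
    ultimately show "2 ^ (card C - 1) \<le> card (strip {p} C) \<and> 2 ^ (card C - 1) \<le> card (shade s {p} C) + card C"
      by simp
  qed
next
  case (join A B)
  have AB: "rich s A" "finite A" "inj_on snd A" "rich s B" "finite B" "inj_on snd B"
    using join.IH[OF join.prems] join.hyps(1,2)[THEN horton_finite] join.hyps(1,2)[THEN horton_inj_snd]
    by simp_all
  show ?case
  proof (cases "s = 1")
    case True
    then show ?thesis
      using rich_join[of s A B] join.hyps(3) AB by auto
  next
    case False
    then have "facing s B A"
      using facing_sym[OF join.hyps(3)] join.prems by simp
    then show ?thesis
      using rich_join[of s B A] AB join.prems by (simp add: Un_commute)
  qed
qed

section \<open>Points enclosed by cups and caps of a Horton set\<close>

text \<open>Bending fixes the orientation of each pair in \<open>C \<inter> N\<close> together with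
  \<open>b\<close>, and \<open>facing\<close> translates this into an order of heights: towards the
  other half they fall for a cup and rise for a cap. A monotone chain bending in this way bulges
  away from the other half.\<close>

lemma half_of_bends_arc:
  assumes f: "facing s N F" and s: "s = 1 \<or> s = - 1" and t: "t = 1 \<or> t = - 1"
    and C: "bends t C" "b \<in> C" "b \<in> F" and inj: "inj_on fst N" "inj_on snd N"
  shows "arc s (C \<inter> N)"
proof -
  have mono: "t * snd q < t * snd p" if pq: "p \<in> C \<inter> N" "q \<in> C \<inter> N" "s * fst p < s * fst q" for p q
  proof -
    have "s * fst q < s * fst b"
      using facingD(4)[OF f, of q b] pq C by simp
    moreover have "ori b q p = - ori p q b"
      unfolding ori_def by algebra
    ultimately have 1: "s * t * ori p q b > 0"
      using s pq bendsD[OF C(1), of p q b] bendsD[OF C(1), of b q p] C by (elim disjE) auto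
    have "snd p \<noteq> snd q"
      using inj_onD[OF inj(2), of p q] pq by auto
    moreover have "snd p < snd q \<Longrightarrow> s * ori p q b < 0" "snd q < snd p \<Longrightarrow> s * ori q p b < 0"
      using facingD(1)[OF f] pq C by auto
    ultimately show ?thesis
      using 1 t ori_swap[of p q b] by (elim disjE) (auto simp: neq_iff)
  qed
  have m: "s * t * snd q < s * t * snd p" if "p \<in> C \<inter> N" "q \<in> C \<inter> N" "fst p < fst q" for p q
    using s mono[of p q] mono[of q p] that by (elim disjE) auto
  have x: "s * t * fst q < s * t * fst p" if "p \<in> C \<inter> N" "q \<in> C \<inter> N" "snd p < snd q" for p q
  proof -
    have "fst p \<noteq> fst q"
      using inj_onD[OF inj(1), of p q] that by auto
    then show ?thesis
      using s t m[of p q] m[of q p] that by (elim disjE) (auto simp: neq_iff)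
  qed
  have "s * ori a b c < 0" if abc: "a \<in> C \<inter> N" "b \<in> C \<inter> N" "c \<in> C \<inter> N" "snd a < snd b" "snd b < snd c" for a b c
  proof -
    have "ori c b a = - ori a b c"
      unfolding ori_def by algebra
    then show ?thesis
      using x[of a b] x[of b c] abc s t bendsD[OF C(1), of a b c] bendsD[OF C(1), of c b a]
      by (elim disjE) auto
  qed
  then show ?thesis
    using m s t unfolding arc_def by (elim disjE) auto
qed

text \<open>A shaded point \<open>z\<close> lies in the triangle \<open>a a' b\<close>: the edge
  from \<open>a\<close> to \<open>a'\<close> is handled by the definition of \<open>shade\<close>,
  the two edges at \<open>b\<close> by \<open>facing\<close>, because the height of \<open>z\<close>
  is between those of \<open>a'\<close> and \<open>a\<close>. For \<open>s = - 1\<close> the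
  triangle is traversed the other way round.\<close>

lemma shade_enclosed:
  assumes f: "facing s N F" and s: "s = 1 \<or> s = - 1"
    and C: "D \<subseteq> C" "D \<subseteq> N" "b \<in> C" "b \<in> F"
  shows "shade s N D \<subseteq> enclosed C"
proof
  fix z assume "z \<in> shade s N D"
  then obtain a a' where a: "z \<in> N" "a \<in> D" "a' \<in> D" "snd a' < snd z" "snd z < snd a" "s * ori a a' z > 0"
    unfolding shade_def by blast
  then have "a \<in> N" "a' \<in> N"
    using C by auto
  then have "s * ori a' z b < 0" "s * ori z a b < 0"
    using facingD(1)[OF f] C a by simp_all
  moreover have "ori a' b z = - ori a' z b" "ori b a z = - ori z a b"
    unfolding ori_def by algebra+
  ultimately have 1: "s * ori a' b z > 0" "s * ori b a z > 0"
    by auto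
  have "a \<in> C" "a' \<in> C"
    using a C by auto
  with 1 a(6) s C show "z \<in> enclosed C"
  proof (elim disjE)
    assume "s = 1"
    then show ?thesis
      using 1 a(6) \<open>a \<in> C\<close> \<open>a' \<in> C\<close> C unfolding enclosed_def by auto
  next
    assume "s = - 1"
    then have "ori a' a z > 0" "ori a b z > 0" "ori b a' z > 0"
      using 1 a(6) ori_swap[of a a' z] ori_swap[of b a z] ori_swap[of a' b z] by auto
    then show ?thesis
      using \<open>a \<in> C\<close> \<open>a' \<in> C\<close> C unfolding enclosed_def by auto
  qed
qed

text \<open>Convexity of the exponential: for a fixed sum of exponents the balanced split is the
  smallest. The induction moves one unit from the larger exponent to the smaller.\<close>

lemma two_powers_ge:
  "(2::nat) ^ ((p + q) div 2) + 2 ^ ((p + q + 1) div 2) \<le> 2 ^ p + 2 ^ q"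
proof (induction p q rule: linorder_wlog)
  case (le p q)
  then show ?case
  proof (induction "q - p" arbitrary: p q rule: less_induct)
    case less
    show ?case
    proof (cases "q \<le> p + 1")
      case True
      then have "q = p \<or> q = p + 1"
        using less.prems by auto
      then show ?thesis
      proof
        assume "q = p + 1"
        then have "(p + q) div 2 = p" "(p + q + 1) div 2 = q" by auto
        then show ?thesis by simp
      qed auto
    next
      case False
      then obtain d where d: "q = Suc d" by (cases q) auto
      have "(2::nat) ^ ((Suc p + d) div 2) + 2 ^ ((Suc p + d + 1) div 2) \<le> 2 ^ Suc p + 2 ^ d"
        using False d by (intro less.hyps) auto
      moreover have "(2::nat) ^ p \<le> 2 ^ d"
        using False d by (intro power_increasing) auto
      ultimately show ?thesis
        unfolding d add_Suc add_Suc_right power_Suc by linarith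
    qed
  qed
next
  case (sym p q)
  then show ?case by (simp add: add_ac)
qed

text \<open>This is the bound \<open>c(r) + 1\<close> for \<open>r = card C\<close>. In the first
  join that splits \<open>C\<close>, both parts are arcs facing each other, and their shades lie in
  different halves, so the counts add up; the worst case is the balanced split.\<close>

lemma horton_enclosed:
  assumes "horton S" "t = 1 \<or> t = - 1" "C \<subseteq> S" "bends t C" "card C \<ge> 2"
  shows "2 ^ ((card C - 2) div 2) + 2 ^ ((card C - 1) div 2) \<le> card (S \<inter> enclosed C) + card C"
  using assms
proof (induction arbitrary: C rule: horton.induct)
  case (single p)
  then have "card C \<le> card {p}"
    by (intro card_mono) auto
  then show ?case
    using single.prems by simp
next
  case (join A B)
  have fin: "finite A" "finite B" "finite C"
    using join.hyps join.prems horton_finite finite_subset[of C "A \<union> B"] by auto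
  have mono: "card (A' \<inter> enclosed C) \<le> card ((A \<union> B) \<inter> enclosed C)" if "A' \<subseteq> A \<union> B" for A'
    using fin that by (intro card_mono) auto
  consider "C \<subseteq> A" | "C \<subseteq> B" | a b where "a \<in> C" "a \<in> A" "b \<in> C" "b \<in> B"
    using join.prems by blast
  then show ?case
  proof cases
    case 1
    then show ?thesis
      using join.IH(1)[OF join.prems(1) _ join.prems(3,4)] mono[of A] by fastforce
  next
    case 2
    then show ?thesis
      using join.IH(2)[OF join.prems(1) _ join.prems(3,4)] mono[of B] by fastforce
  next
    case (3 a b)
    let ?A = "C \<inter> A" and ?B = "C \<inter> B"
    note f = join.hyps(3) and f' = facing_sym[OF join.hyps(3)]
    note inj = horton_inj_fst horton_inj_snd
    have disj: "A \<inter> B = {}"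
      using facingD(3)[OF f] by blast
    have arcs: "arc 1 ?A" "arc (- 1) ?B"
      using half_of_bends_arc[OF f _ join.prems(1,3) 3(3,4)] half_of_bends_arc[OF f' _ join.prems(1,3) 3(1,2)]
        inj join.hyps by auto
    have "?A \<noteq> {}" "?B \<noteq> {}"
      using 3 by auto
    then have cards: "2 ^ (card ?A - 1) \<le> card (shade 1 A ?A) + card ?A"
      "2 ^ (card ?B - 1) \<le> card (shade (- 1) B ?B) + card ?B"
      "card ?A \<ge> 1" "card ?B \<ge> 1"
      using horton_rich[OF join.hyps(1), of 1] horton_rich[OF join.hyps(2), of "- 1"] arcs fin
      unfolding rich_def by (auto simp: Suc_le_eq card_gt_0_iff)
    have "C = ?A \<union> ?B"
      using join.prems by blast
    then have "card C = card ?A + card ?B"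
      using fin disj by (metis Int_Un_eq(2) card_Un_disjoint finite_Int inf_assoc inf_bot_right inf_left_commute)
    moreover have "shade 1 A ?A \<union> shade (- 1) B ?B \<subseteq> (A \<union> B) \<inter> enclosed C"
      using shade_enclosed[OF f, of ?A C b] shade_enclosed[OF f', of ?B C a] 3
      by (auto simp: shade_def)
    then have "card (shade 1 A ?A \<union> shade (- 1) B ?B) \<le> card ((A \<union> B) \<inter> enclosed C)"
      using fin by (intro card_mono) auto
    moreover have "card (shade 1 A ?A \<union> shade (- 1) B ?B) = card (shade 1 A ?A) + card (shade (- 1) B ?B)"
      using fin disj by (intro card_Un_disjoint) (auto simp: shade_def)
    moreover have "(2::nat) ^ ((card C - 2) div 2) + 2 ^ ((card C - 1) div 2) \<le> 2 ^ (card ?A - 1) + 2 ^ (card ?B - 1)"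
    proof -
      have e: "card C - 2 = card ?A - 1 + (card ?B - 1)" "card C - 1 = card ?A - 1 + (card ?B - 1) + 1"
        using cards(3,4) calculation(1) by auto
      show ?thesis
        unfolding e by (rule two_powers_ge)
    qed
    ultimately show ?thesis
      using cards by linarith
  qed
qed

section \<open>Existence of arbitrarily large Horton sets\<close>

lemma ori_affine:
  "ori (e * fst p + c, k * snd p + d) (e * fst q + c, k * snd q + d) (e * fst r + c, k * snd r + d) =
    e * k * ori p q r"
  unfolding ori_def fst_conv snd_conv by algebra

lemma facing_affine:
  fixes c d :: real
  assumes "facing s A B" "e > 0" "k > 0"
  defines "f \<equiv> \<lambda>p::point. (e * fst p + c, k * snd p + d)"
  shows "facing s (f ` A) (f ` B)"
proof -
  have 1: "ori (f p) (f q) (f r) = e * k * ori p q r" for p q r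
    unfolding f_def by (rule ori_affine)
  have "s * ori (f p) (f q) (f r) < 0 \<longleftrightarrow> s * ori p q r < 0"
    "s * ori (f p) (f q) (f r) > 0 \<longleftrightarrow> s * ori p q r > 0" for p q r
  proof -
    have "s * ori (f p) (f q) (f r) = (e * k) * (s * ori p q r)" "e * k > 0"
      using 1 assms by auto
    then show "s * ori (f p) (f q) (f r) < 0 \<longleftrightarrow> s * ori p q r < 0"
      "s * ori (f p) (f q) (f r) > 0 \<longleftrightarrow> s * ori p q r > 0"
      by (simp_all only: mult_less_0_iff zero_less_mult_iff) auto
  qed
  moreover have "snd (f p) < snd (f q) \<longleftrightarrow> snd p < snd q" "snd (f p) = snd (f q) \<longleftrightarrow> snd p = snd q" for p q
    using assms unfolding f_def by auto
  moreover have "s * fst (f p) < s * fst (f q) \<longleftrightarrow> s * fst p < s * fst q" for p q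
  proof -
    have "s * fst (f q) - s * fst (f p) = e * (s * fst q - s * fst p)"
      unfolding f_def by (simp add: algebra_simps)
    then show ?thesis
      using assms(2) by (metis diff_gt_0_iff_gt zero_less_mult_iff less_asym)
  qed
  ultimately show ?thesis
    using assms(1) unfolding facing_def by simp
qed

lemma horton_affine:
  "horton S \<Longrightarrow> e > 0 \<Longrightarrow> k > 0 \<Longrightarrow> horton ((\<lambda>p. (e * fst p + c, k * snd p + d)) ` S)"
proof (induction rule: horton.induct)
  case (join A B)
  then show ?case
    unfolding image_Un by (intro horton.join facing_affine) auto
qed (auto intro: horton.single)

text \<open>A strict inequality valid at the limit \<open>e = 0\<close> persists for small positive
  \<open>e\<close>. The constant premise \<open>P\<close> lets it be used under finite quantifiers
  with side conditions, so that one \<open>e\<close> serves all cases.\<close>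

lemma eventually_pos_at_right_0:
  fixes F :: "real \<Rightarrow> real"
  assumes "P \<Longrightarrow> isCont F 0" "P \<Longrightarrow> F 0 > 0"
  shows "eventually (\<lambda>e. P \<longrightarrow> F e > 0) (at_right 0)"
proof (cases P)
  case True
  then have "eventually (\<lambda>e. F e > 0) (at 0)"
    using assms unfolding isCont_def by (intro order_tendstoD)
  then have "eventually (\<lambda>e. F e > 0) (at_right 0)"
    by (rule filter_leD[OF at_le, rotated]) simp
  then show ?thesis
    using True by simp
qed simp

text \<open>Two copies of \<open>S\<close> are put at the even and the odd heights and squeezed
  horizontally towards the lines \<open>x = 0\<close> and \<open>x = 1\<close>; in the limit the
  conditions of \<open>facing\<close> on orientations are strict. Consecutive integer heights make
  the interlacing exact and are reproduced by the doubling.\<close>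

lemma horton_exists: "\<exists>S. horton S \<and> snd ` S = real ` {..<2 ^ n}"
proof (induction n)
  case 0
  have "horton {(0, 0)}"
    by (rule horton.single)
  then show ?case
    by (intro exI[of _ "{(0, 0)}"]) (simp add: lessThan_Suc)
next
  case (Suc n)
  then obtain S where S: "horton S" "snd ` S = real ` {..<2 ^ n}"
    by blast
  note fin = horton_finite[OF S(1)]
  define f g :: "real \<Rightarrow> point \<Rightarrow> point"
    where "f = (\<lambda>e p. (e * fst p + 0, 2 * snd p + 0))" and "g = (\<lambda>e p. (e * fst p + 1, 2 * snd p + 1))"
  have "eventually (\<lambda>e. \<forall>p\<in>S. \<forall>q\<in>S. \<forall>r\<in>S. snd p < snd q \<longrightarrow> - ori (f e p) (f e q) (g e r) > 0) (at_right 0)"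
    unfolding f_def g_def ori_def
    by (intro eventually_ball_finite fin ballI eventually_pos_at_right_0) (auto intro!: continuous_intros)
  moreover have "eventually (\<lambda>e. \<forall>p\<in>S. \<forall>q\<in>S. \<forall>r\<in>S. snd p < snd q \<longrightarrow> ori (g e p) (g e q) (f e r) > 0) (at_right 0)"
    unfolding f_def g_def ori_def
    by (intro eventually_ball_finite fin ballI eventually_pos_at_right_0) (auto intro!: continuous_intros)
  moreover have "eventually (\<lambda>e. \<forall>p\<in>S. \<forall>q\<in>S. True \<longrightarrow> fst (g e q) - fst (f e p) > 0) (at_right 0)"
    unfolding f_def g_def
    by (intro eventually_ball_finite fin ballI eventually_pos_at_right_0) (auto intro!: continuous_intros)
  moreover have "eventually (\<lambda>e::real. e > 0) (at_right 0)"
    by (rule eventually_at_right_less)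
  ultimately have "eventually (\<lambda>e. e > 0 \<and>
      (\<forall>p\<in>S. \<forall>q\<in>S. \<forall>r\<in>S. snd p < snd q \<longrightarrow> - ori (f e p) (f e q) (g e r) > 0) \<and>
      (\<forall>p\<in>S. \<forall>q\<in>S. \<forall>r\<in>S. snd p < snd q \<longrightarrow> ori (g e p) (g e q) (f e r) > 0) \<and>
      (\<forall>p\<in>S. \<forall>q\<in>S. True \<longrightarrow> fst (g e q) - fst (f e p) > 0)) (at_right 0)"
    by eventually_elim blast
  then obtain e where e: "e > 0"
      "\<And>p q r. p \<in> S \<Longrightarrow> q \<in> S \<Longrightarrow> r \<in> S \<Longrightarrow> snd p < snd q \<Longrightarrow> ori (f e p) (f e q) (g e r) < 0"
      "\<And>p q r. p \<in> S \<Longrightarrow> q \<in> S \<Longrightarrow> r \<in> S \<Longrightarrow> snd p < snd q \<Longrightarrow> ori (g e p) (g e q) (f e r) > 0"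
      "\<And>p q. p \<in> S \<Longrightarrow> q \<in> S \<Longrightarrow> fst (f e p) < fst (g e q)"
    by (auto dest!: eventually_happens'[OF trivial_limit_at_right_real])
  have f: "snd (f e p) = 2 * snd p" and g: "snd (g e p) = 2 * snd p + 1" for p
    unfolding f_def g_def by auto
  have nat: "\<exists>i. snd p = real i \<and> i < 2 ^ n" if "p \<in> S" for p
    using S(2) that by (metis imageE image_eqI lessThan_iff)
  have "facing 1 (f e ` S) (g e ` S)"
    unfolding facing_def
  proof (intro conjI ballI impI)
    fix a b assume "a \<in> f e ` S" "b \<in> g e ` S"
    then obtain p q where "a = f e p" "b = g e q" "p \<in> S" "q \<in> S"
      by blast
    moreover obtain i j where "snd p = real i" "snd q = real j"
      using nat calculation by blast
    then have "2 * snd p \<noteq> 2 * snd q + 1"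
      by (metis One_nat_def double_not_eq_Suc_double of_nat_1 of_nat_add of_nat_eq_iff of_nat_mult
          of_nat_numeral add.commute plus_1_eq_Suc)
    ultimately show "snd a \<noteq> snd b" "1 * fst a < 1 * fst b"
      using f g e(4) by simp_all
  next
    fix a a' assume "a \<in> f e ` S" "a' \<in> f e ` S" "snd a < snd a'"
    then obtain p q where pq: "a = f e p" "a' = f e q" "p \<in> S" "q \<in> S" "snd p < snd q"
      using f by auto
    moreover obtain i j where "snd p = real i" "snd q = real j"
      using nat pq by blast
    ultimately have "snd a < snd (g e p)" "snd (g e p) < snd a'"
      using f g by auto
    then show "\<exists>b\<in>g e ` S. snd a < snd b \<and> snd b < snd a'"
      using pq by blast
  next
    fix a a' assume "a \<in> g e ` S" "a' \<in> g e ` S" "snd a < snd a'"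
    then obtain p q where pq: "a = g e p" "a' = g e q" "p \<in> S" "q \<in> S" "snd p < snd q"
      using g by auto
    moreover obtain i j where "snd p = real i" "snd q = real j"
      using nat pq by blast
    ultimately have "snd a < snd (f e q)" "snd (f e q) < snd a'"
      using f g by auto
    then show "\<exists>b\<in>f e ` S. snd a < snd b \<and> snd b < snd a'"
      using pq by blast
  qed (use e f g in auto)
  moreover have "horton (f e ` S)" "horton (g e ` S)"
    using horton_affine[OF S(1) e(1), of 2 0 0] horton_affine[OF S(1) e(1), of 2 1 1]
    unfolding f_def g_def by auto
  ultimately have "horton (f e ` S \<union> g e ` S)"
    by (intro horton.join)
  moreover have "snd ` (f e ` S \<union> g e ` S) = real ` {..<2 ^ Suc n}"
  proof -
    have "snd ` (f e ` S \<union> g e ` S) = (\<lambda>y. 2 * y) ` snd ` S \<union> (\<lambda>y. 2 * y + 1) ` snd ` S"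
      using f g by (auto simp: image_Un image_image)
    also have "\<dots> = real ` ((\<lambda>i. 2 * i) ` {..<2 ^ n} \<union> (\<lambda>i. 2 * i + 1) ` {..<2 ^ n})"
      unfolding S(2) by (simp add: image_Un image_image add.commute)
    also have "(\<lambda>i. 2 * i) ` {..<2 ^ n} \<union> (\<lambda>i. 2 * i + 1) ` {..<2 ^ n} = {..<2 ^ Suc n :: nat}"
    proof (rule set_eqI)
      fix i :: nat
      have "i \<in> {..<2 ^ Suc n} \<Longrightarrow> i div 2 < 2 ^ n" by auto
      moreover have "i = 2 * (i div 2) \<or> i = 2 * (i div 2) + 1" by presburger
      ultimately show "i \<in> (\<lambda>i. 2 * i) ` {..<2 ^ n} \<union> (\<lambda>i. 2 * i + 1) ` {..<2 ^ n} \<longleftrightarrow> i \<in> {..<2 ^ Suc n}"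
        by auto
    qed
    finally show ?thesis .
  qed
  ultimately show ?case
    by blast
qed

section \<open>Replacing points by steep clusters\<close>

definition general :: "point set \<Rightarrow> bool" where
  "general S \<longleftrightarrow> finite S \<and> inj_on fst S \<and>
     (\<forall>p\<in>S. \<forall>q\<in>S. \<forall>r\<in>S. p \<noteq> q \<and> q \<noteq> r \<and> p \<noteq> r \<longrightarrow> ori p q r \<noteq> 0)"

lemma general_admissible: "general S \<Longrightarrow> admissible S"
  unfolding general_def admissible_def inj_on_def
  by (metis collinear_imp_ori_eq_0)

lemma horton_general: "horton S \<Longrightarrow> general S"
  unfolding general_def using horton_finite horton_inj_fst horton_ori_nz by blast

text \<open>All chords of a cluster must rise, so that squeezing makes them almost vertical and
  pointing upwards from left to right; this decides how a cluster is seen from the others.\<close>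

definition steep :: "point set \<Rightarrow> bool" where
  "steep S \<longleftrightarrow> (\<forall>p\<in>S. \<forall>q\<in>S. fst p < fst q \<longrightarrow> snd p < snd q)"

lemma pos_if_same_sgn:
  fixes x y t :: real
  shows "t * x > 0 \<Longrightarrow> sgn x = sgn y \<Longrightarrow> t * y > 0"
  by (cases x "0::real" rule: linorder_cases; cases y "0::real" rule: linorder_cases)
    (auto simp: zero_less_mult_iff)

text \<open>\<open>b y z\<close> is the copy of \<open>z\<close> in the cluster at \<open>y\<close>.
  The locale keeps only the order and orientation facts and forgets the scale. Clusters may vary
  with \<open>y\<close>: the small sets glue two different ones, the Horton set carries copies of a
  single one.\<close>

locale inflation =
  fixes Y :: "point set" and Z :: "point \<Rightarrow> point set" and b :: "point \<Rightarrow> point \<Rightarrow> point"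
  assumes Y: "general Y" and Z: "\<And>y. y \<in> Y \<Longrightarrow> general (Z y)"
    and fst_outer: "\<And>y y' z z'. \<lbrakk>y \<in> Y; y' \<in> Y; z \<in> Z y; z' \<in> Z y'; fst y < fst y'\<rbrakk> \<Longrightarrow> fst (b y z) < fst (b y' z')"
    and snd_outer: "\<And>y y' z z'. \<lbrakk>y \<in> Y; y' \<in> Y; z \<in> Z y; z' \<in> Z y'; snd y < snd y'\<rbrakk> \<Longrightarrow> snd (b y z) < snd (b y' z')"
    and fst_inner: "\<And>y z z'. \<lbrakk>y \<in> Y; z \<in> Z y; z' \<in> Z y; fst z < fst z'\<rbrakk> \<Longrightarrow> fst (b y z) < fst (b y z')"
    and snd_inner: "\<And>y z z'. \<lbrakk>y \<in> Y; z \<in> Z y; z' \<in> Z y; snd z < snd z'\<rbrakk> \<Longrightarrow> snd (b y z) < snd (b y z')"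
    and ori_outer: "\<And>y y' y'' z z' z''. \<lbrakk>y \<in> Y; y' \<in> Y; y'' \<in> Y; z \<in> Z y; z' \<in> Z y'; z'' \<in> Z y''; ori y y' y'' > 0\<rbrakk>
      \<Longrightarrow> ori (b y z) (b y' z') (b y'' z'') > 0"
    and ori_mixed: "\<And>y y' z z' w. \<lbrakk>y \<in> Y; y' \<in> Y; z \<in> Z y; z' \<in> Z y; w \<in> Z y'; fst z < fst z'; y \<noteq> y'\<rbrakk>
      \<Longrightarrow> (fst y' - fst y) * ori (b y z) (b y z') (b y' w) < 0"
    and ori_inner: "\<And>y z z' z''. \<lbrakk>y \<in> Y; z \<in> Z y; z' \<in> Z y; z'' \<in> Z y; ori z z' z'' > 0\<rbrakk>
      \<Longrightarrow> ori (b y z) (b y z') (b y z'') > 0"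

text \<open>Shrinking by \<open>e^2\<close> horizontally but by \<open>e\<close> vertically makes
  the slopes inside a cluster grow like \<open>1 / e\<close>, while orientations inside it are
  merely multiplied by \<open>e^3\<close>.\<close>

lemma inflation_exists:
  assumes Y: "general Y" and Z: "\<And>y. y \<in> Y \<Longrightarrow> general (Z y)" "\<And>y. y \<in> Y \<Longrightarrow> steep (Z y)"
  shows "\<exists>b. inflation Y Z b"
proof -
  define b :: "real \<Rightarrow> point \<Rightarrow> point \<Rightarrow> point"
    where "b = (\<lambda>e y z. (fst y + e\<^sup>2 * fst z, snd y + e * snd z))"
  have fin: "finite Y" "\<And>y. y \<in> Y \<Longrightarrow> finite (Z y)"
    using Y Z unfolding general_def by auto
  \<comment> \<open>Mixed orientations vanish at \<open>e = 0\<close>, so continuity cannot be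
    applied to them directly. \<open>G\<close> is what remains of the mixed expression after
    division by \<open>- e\<close>; at \<open>e = 0\<close> it equals
    \<open>(fst y' - fst y)^2 * (snd z' - snd z)\<close>.\<close>
  define G :: "real \<Rightarrow> point \<Rightarrow> point \<Rightarrow> point \<Rightarrow> point \<Rightarrow> point \<Rightarrow> real"
    where "G = (\<lambda>e y y' z z' w. (fst y' - fst y) *
    ((snd z' - snd z) * (fst y' + e\<^sup>2 * fst w - (fst y + e\<^sup>2 * fst z)) -
     e * (fst z' - fst z) * (snd y' + e * snd w - (snd y + e * snd z))))"
  have G: "(fst y' - fst y) * ori (b e y z) (b e y z') (b e y' w) = - e * G e y y' z z' w" for e y y' z z' w
    unfolding G_def b_def ori_def fst_conv snd_conv by algebra
  have inner: "ori (b e y z) (b e y z') (b e y z'') = e ^ 3 * ori z z' z''" for e y z z' z''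
    unfolding b_def ori_def fst_conv snd_conv by algebra
  have "eventually (\<lambda>e. \<forall>y\<in>Y. \<forall>y'\<in>Y. \<forall>z\<in>Z y. \<forall>z'\<in>Z y'. fst y < fst y' \<longrightarrow> fst (b e y' z') - fst (b e y z) > 0) (at_right 0)"
    unfolding b_def
    by (intro eventually_ball_finite fin ballI eventually_pos_at_right_0) (auto intro!: continuous_intros)
  moreover have "eventually (\<lambda>e. \<forall>y\<in>Y. \<forall>y'\<in>Y. \<forall>z\<in>Z y. \<forall>z'\<in>Z y'. snd y < snd y' \<longrightarrow> snd (b e y' z') - snd (b e y z) > 0) (at_right 0)"
    unfolding b_def
    by (intro eventually_ball_finite fin ballI eventually_pos_at_right_0) (auto intro!: continuous_intros)
  moreover have "eventually (\<lambda>e. \<forall>y\<in>Y. \<forall>y'\<in>Y. \<forall>y''\<in>Y. \<forall>z\<in>Z y. \<forall>z'\<in>Z y'. \<forall>z''\<in>Z y''.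
      ori y y' y'' > 0 \<longrightarrow> ori (b e y z) (b e y' z') (b e y'' z'') > 0) (at_right 0)"
    unfolding b_def ori_def
    by (intro eventually_ball_finite fin ballI eventually_pos_at_right_0) (auto intro!: continuous_intros)
  moreover have "eventually (\<lambda>e. \<forall>y\<in>Y. \<forall>y'\<in>Y. \<forall>z\<in>Z y. \<forall>z'\<in>Z y. \<forall>w\<in>Z y'.
      fst z < fst z' \<and> y \<noteq> y' \<longrightarrow> G e y y' z z' w > 0) (at_right 0)"
  proof (intro eventually_ball_finite fin ballI eventually_pos_at_right_0)
    fix y y' z z' w assume *: "y \<in> Y" "y' \<in> Y" "z \<in> Z y" "z' \<in> Z y" "fst z < fst z' \<and> y \<noteq> y'"
    then have "snd z < snd z'"
      using Z(2) unfolding steep_def by blast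
    moreover have "fst y \<noteq> fst y'"
      using Y * unfolding general_def inj_on_def by blast
    ultimately show "G 0 y y' z z' w > 0"
      unfolding G_def by (auto simp: zero_less_mult_iff mult_less_0_iff)
  qed (auto intro!: continuous_intros simp: G_def)
  moreover have "eventually (\<lambda>e::real. e > 0) (at_right 0)"
    by (rule eventually_at_right_less)
  ultimately have "eventually (\<lambda>e. inflation Y Z (b e)) (at_right 0)"
  proof eventually_elim
    case (elim e)
    show ?case
    proof
      fix y y' z z' w assume *: "y \<in> Y" "y' \<in> Y" "z \<in> Z y" "z' \<in> Z y" "w \<in> Z y'" "fst z < fst z'" "y \<noteq> y'"
      then have "G e y y' z z' w > 0"
        using elim(4) by blast
      then show "(fst y' - fst y) * ori (b e y z) (b e y z') (b e y' w) < 0"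
        unfolding G using elim(5) by simp
    next
      fix y z z' :: point assume "fst z < fst z'"
      then show "fst (b e y z) < fst (b e y z')"
        using elim(5) unfolding b_def by simp
    next
      fix y z z' :: point assume "snd z < snd z'"
      then show "snd (b e y z) < snd (b e y z')"
        using elim(5) unfolding b_def by simp
    next
      fix y z z' z'' assume "ori z z' z'' > 0"
      then show "ori (b e y z) (b e y z') (b e y z'') > 0"
        unfolding inner using elim(5) by simp
    next
      fix y y' z z' assume "y \<in> Y" "y' \<in> Y" "z \<in> Z y" "z' \<in> Z y'"
      then show "fst y < fst y' \<Longrightarrow> fst (b e y z) < fst (b e y' z')"
        "snd y < snd y' \<Longrightarrow> snd (b e y z) < snd (b e y' z')"
        using elim(1,2) by simp_all
    next
      fix y y' y'' z z' z'' assume "y \<in> Y" "y' \<in> Y" "y'' \<in> Y" "z \<in> Z y" "z' \<in> Z y'" "z'' \<in> Z y''" "ori y y' y'' > 0"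
      then show "ori (b e y z) (b e y' z') (b e y'' z'') > 0"
        using elim(3) by blast
    qed (use Y Z in auto)
  qed
  then show ?thesis
    by (auto dest!: eventually_happens'[OF trivial_limit_at_right_real])
qed

section \<open>Cups, caps and enclosed points of an inflated set\<close>

context inflation
begin

definition fibre :: "point set \<Rightarrow> point \<Rightarrow> point set" where
  "fibre C y = {z\<in>Z y. b y z \<in> C}"

definition whole :: "point set" where
  "whole = (\<Union>y\<in>Y. b y ` Z y)"

lemma b_eq_iff:
  assumes "y \<in> Y" "y' \<in> Y" "z \<in> Z y" "z' \<in> Z y'" "fst (b y z) = fst (b y' z')"
  shows "y = y' \<and> z = z'"
proof -
  have "fst y = fst y'"
    using fst_outer[of y y' z z'] fst_outer[of y' y z' z] assms by (metis less_irrefl linorder_neqE)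
  then have y: "y = y'"
    using Y assms unfolding general_def by (auto dest: inj_onD)
  then have "fst z = fst z'"
    using fst_inner[of y z z'] fst_inner[of y z' z] assms by (metis less_irrefl linorder_neqE)
  then show ?thesis
    using y Z[of y] assms unfolding general_def by (auto dest: inj_onD)
qed

lemma finites: "finite Y" "y \<in> Y \<Longrightarrow> finite (Z y)" "y \<in> Y \<Longrightarrow> finite (fibre C y)" "finite whole"
proof -
  show Y': "finite Y"
    using Y unfolding general_def by blast
  have Z': "finite (Z y)" if "y \<in> Y" for y
    using Z that unfolding general_def by blast
  then show "finite (Z y)" if "y \<in> Y"
    using that by blast
  show "finite (fibre C y)" if "y \<in> Y"
    using Z'[OF that] unfolding fibre_def by simp
  show "finite whole"
    using Y' Z' unfolding whole_def by blast
qed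

lemma card_fibres:
  assumes "C \<subseteq> whole"
  shows "card C = (\<Sum>y\<in>Y. card (fibre C y))"
proof -
  have "C = (\<lambda>(y, z). b y z) ` (SIGMA y:Y. fibre C y)"
    using assms unfolding whole_def fibre_def by force
  moreover have "inj_on (\<lambda>(y, z). b y z) (SIGMA y:Y. fibre C y)"
    using b_eq_iff unfolding fibre_def inj_on_def by auto
  ultimately have "card C = card (SIGMA y:Y. fibre C y)"
    using card_image by metis
  then show ?thesis
    using finites by (simp add: fibre_def)
qed

lemma card_whole: "card whole = (\<Sum>y\<in>Y. card (Z y))"
proof -
  have "fibre whole y = Z y" if "y \<in> Y" for y
    using that unfolding fibre_def whole_def by auto
  then show ?thesis
    using card_fibres[of whole] by simp
qed

lemma ori_outer_sign:
  assumes y: "y \<in> Y" "y' \<in> Y" "y'' \<in> Y" and z: "z \<in> Z y" "z' \<in> Z y'" "z'' \<in> Z y''"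
    and ne: "y \<noteq> y'" "y' \<noteq> y''" "y \<noteq> y''"
  shows "sgn (ori (b y z) (b y' z') (b y'' z'')) = sgn (ori y y' y'')" "ori y y' y'' \<noteq> 0"
proof -
  show nz: "ori y y' y'' \<noteq> 0"
    using Y y ne unfolding general_def by blast
  have "ori y' y y'' > 0 \<Longrightarrow> ori (b y' z') (b y z) (b y'' z'') > 0"
    using ori_outer y z by blast
  moreover have "ori y y' y'' > 0 \<Longrightarrow> ori (b y z) (b y' z') (b y'' z'') > 0"
    using ori_outer y z by blast
  ultimately show "sgn (ori (b y z) (b y' z') (b y'' z'')) = sgn (ori y y' y'')"
    using nz ori_swap[of y y' y''] ori_swap[of "b y z" "b y' z'" "b y'' z''"]
    by (cases "ori y y' y'' > 0") auto
qed

lemma ori_inner_sign: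
  assumes y: "y \<in> Y" and z: "z \<in> Z y" "z' \<in> Z y" "z'' \<in> Z y" and ne: "z \<noteq> z'" "z' \<noteq> z''" "z \<noteq> z''"
  shows "sgn (ori (b y z) (b y z') (b y z'')) = sgn (ori z z' z'')" "ori z z' z'' \<noteq> 0"
proof -
  show nz: "ori z z' z'' \<noteq> 0"
    using Z[OF y] z ne unfolding general_def by blast
  have "ori z' z z'' > 0 \<Longrightarrow> ori (b y z') (b y z) (b y z'') > 0"
    using ori_inner y z by blast
  moreover have "ori z z' z'' > 0 \<Longrightarrow> ori (b y z) (b y z') (b y z'') > 0"
    using ori_inner y z by blast
  ultimately show "sgn (ori (b y z) (b y z') (b y z'')) = sgn (ori z z' z'')"
    using nz ori_swap[of z z' z''] ori_swap[of "b y z" "b y z'" "b y z''"]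
    by (cases "ori z z' z'' > 0") auto
qed

lemma ori_mixed_nz:
  assumes "y \<in> Y" "y' \<in> Y" "z \<in> Z y" "z' \<in> Z y" "w \<in> Z y'" "z \<noteq> z'" "y \<noteq> y'"
  shows "ori (b y z) (b y z') (b y' w) \<noteq> 0"
proof -
  have "fst z \<noteq> fst z'"
    using Z[OF assms(1)] assms unfolding general_def by (auto dest: inj_onD)
  then show ?thesis
    using ori_mixed[of y y' z z' w] ori_mixed[of y y' z' z w] assms
      ori_swap[of "b y z" "b y z'" "b y' w"]
    by (cases "fst z < fst z'") auto
qed

lemma general_whole: "general whole"
  unfolding general_def
proof (intro conjI ballI impI)
  show "finite whole"
    by (rule finites)
  show "inj_on fst whole"
  proof (rule inj_onI)
    fix p q assume "p \<in> whole" "q \<in> whole" "fst p = fst q"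
    then obtain y y' z z' where "p = b y z" "q = b y' z'" "y \<in> Y" "y' \<in> Y" "z \<in> Z y" "z' \<in> Z y'"
      unfolding whole_def by blast
    then show "p = q"
      using b_eq_iff[of y y' z z'] \<open>fst p = fst q\<close> by simp
  qed
  fix p q r assume "p \<in> whole" "q \<in> whole" "r \<in> whole" and ne: "p \<noteq> q \<and> q \<noteq> r \<and> p \<noteq> r"
  then obtain y z y' z' y'' z'' where
    pqr: "p = b y z" "q = b y' z'" "r = b y'' z''" and
    Y: "y \<in> Y" "y' \<in> Y" "y'' \<in> Y" and Z: "z \<in> Z y" "z' \<in> Z y'" "z'' \<in> Z y''"
    unfolding whole_def by blast
  consider "y = y'" "y' = y''" | "y = y'" "y \<noteq> y''" | "y' = y''" "y \<noteq> y'" | "y'' = y" "y \<noteq> y'"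
    | "y \<noteq> y'" "y' \<noteq> y''" "y \<noteq> y''"
    by blast
  then show "ori p q r \<noteq> 0"
  proof cases
    case 1
    then have "z \<noteq> z'" "z' \<noteq> z''" "z \<noteq> z''"
      using ne pqr by auto
    then show ?thesis
      using ori_inner_sign[of y z z' z''] Y Z 1 pqr by (metis sgn_0_0)
  next
    case 2
    then show ?thesis
      using ori_mixed_nz[of y y'' z z' z''] Y Z pqr ne by auto
  next
    case 3
    then show ?thesis
      using ori_mixed_nz[of y' y z' z'' z] Y Z pqr ne ori_rotate[of q r p] by auto
  next
    case 4
    then show ?thesis
      using ori_mixed_nz[of y'' y' z'' z z'] Y Z pqr ne ori_rotate[of p q r] by auto
  next
    case 5
    then show ?thesis
      using ori_outer_sign[of y y' y'' z z' z''] Y Z pqr by (metis sgn_0_0)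
  qed
qed

lemma bends_outer:
  assumes C: "bends t C" and D: "D \<subseteq> Y" "\<And>y. y \<in> D \<Longrightarrow> fibre C y \<noteq> {}"
  shows "bends t D"
  unfolding bends_def
proof (intro ballI impI)
  fix p q r assume pqr: "p \<in> D" "q \<in> D" "r \<in> D" "fst p < fst q" "fst q < fst r"
  have "fibre C p \<noteq> {}" "fibre C q \<noteq> {}" "fibre C r \<noteq> {}"
    using D(2) pqr(1-3) by simp_all
  then obtain z z' z'' where "z \<in> fibre C p" "z' \<in> fibre C q" "z'' \<in> fibre C r"
    unfolding ex_in_conv[symmetric] by (elim exE)
  then have z: "z \<in> Z p" "z' \<in> Z q" "z'' \<in> Z r" and c: "b p z \<in> C" "b q z' \<in> C" "b r z'' \<in> C"
    unfolding fibre_def by simp_all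
  have Y: "p \<in> Y" "q \<in> Y" "r \<in> Y"
    using pqr(1-3) by (simp_all add: subsetD[OF D(1)])
  have "t * ori (b p z) (b q z') (b r z'') > 0"
    by (rule bendsD[OF C c]) (rule fst_outer; fact)+
  moreover have "p \<noteq> q" "q \<noteq> r" "p \<noteq> r"
    using pqr(4,5) by auto
  then have "sgn (ori (b p z) (b q z') (b r z'')) = sgn (ori p q r)"
    by (rule ori_outer_sign(1)[OF Y z])
  ultimately show "t * ori p q r > 0"
    by (rule pos_if_same_sgn)
qed

lemma bends_fibre:
  assumes C: "bends t C" and y: "y \<in> Y"
  shows "bends t (fibre C y)"
  unfolding bends_def
proof (intro ballI impI)
  fix p q r assume pqr: "p \<in> fibre C y" "q \<in> fibre C y" "r \<in> fibre C y" "fst p < fst q" "fst q < fst r"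
  have "t * ori (b y p) (b y q) (b y r) > 0"
    using bendsD[OF C] fst_inner y pqr unfolding fibre_def by blast
  moreover have "sgn (ori (b y p) (b y q) (b y r)) = sgn (ori p q r)"
    using y pqr unfolding fibre_def by (intro ori_inner_sign) auto
  ultimately show "t * ori p q r > 0"
    by (rule pos_if_same_sgn)
qed

text \<open>Two points of a cluster span an almost vertical chord. A point to its right completes it
  to a clockwise turn, a point to its left to a counterclockwise one. Hence a cup can use several
  points only of its last cluster, a cap only of its first.\<close>

lemma multiple_fibre_extreme:
  assumes C: "bends t C" and y: "y \<in> Y" "y' \<in> Y" "y \<noteq> y'"
    and z: "card (fibre C y) \<ge> 2" "w \<in> fibre C y'"
  shows "t * (fst y - fst y') > 0"
proof -
  obtain u v where "u \<in> fibre C y" "v \<in> fibre C y" "u \<noteq> v"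
    using z(1) by (metis card_le_Suc0_iff_eq card.infinite not_less_eq_eq numeral_2_eq_2 zero_le)
  moreover have "fst u \<noteq> fst v"
    using calculation Z[OF y(1)] unfolding general_def fibre_def by (auto dest: inj_onD)
  ultimately obtain z z' where z': "z \<in> fibre C y" "z' \<in> fibre C y" "fst z < fst z'"
    by (metis linorder_neqE)
  let ?o = "ori (b y z) (b y z') (b y' w)"
  have mixed: "(fst y' - fst y) * ?o < 0"
    using ori_mixed y z z' unfolding fibre_def by blast
  have mem: "b y z \<in> C" "b y z' \<in> C" "b y' w \<in> C" "fst (b y z) < fst (b y z')"
    using z z' y fst_inner unfolding fibre_def by auto
  have "fst y \<noteq> fst y'"
    using Y y unfolding general_def by (auto dest: inj_onD)
  then consider "fst y < fst y'" | "fst y' < fst y"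
    by linarith
  then show ?thesis
  proof cases
    case 1
    then have "fst (b y z') < fst (b y' w)"
      using fst_outer z z' y unfolding fibre_def by blast
    then have "t * ?o > 0"
      using bendsD[OF C] mem by blast
    moreover have "?o < 0"
      using mixed 1 by (simp add: mult_less_0_iff)
    ultimately show ?thesis
      using 1 by (simp add: zero_less_mult_iff)
  next
    case 2
    then have "fst (b y' w) < fst (b y z)"
      using fst_outer z z' y unfolding fibre_def by blast
    then have "t * ?o > 0"
      using bendsD[OF C, of "b y' w" "b y z" "b y z'"] mem ori_rotate[of "b y z" "b y z'" "b y' w"] by simp
    moreover have "?o > 0"
      using mixed 2 by (simp add: mult_less_0_iff)
    ultimately show ?thesis
      using 2 by (simp add: zero_less_mult_iff)
  qed
qed

text \<open>Two clusters used more than once would each have to lie beyond the other, so at most one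
  exists, and it contributes at most \<open>k\<close> points beyond its first.\<close>

lemma card_bends_le:
  assumes C: "bends t C" "C \<subseteq> whole"
    and k: "\<And>y. y \<in> Y \<Longrightarrow> card (fibre C y) \<le> k + 1"
  shows "card C \<le> card {y\<in>Y. fibre C y \<noteq> {}} + k"
proof -
  let ?D = "{y\<in>Y. fibre C y \<noteq> {}}"
  have finD: "finite ?D"
    using finites by simp
  have card: "card C = (\<Sum>y\<in>?D. card (fibre C y))"
    unfolding card_fibres[OF C(2)] using finites by (intro sum.mono_neutral_right) auto
  show ?thesis
  proof (cases "\<exists>y\<in>?D. card (fibre C y) \<ge> 2")
    case False
    then have "card C \<le> (\<Sum>y\<in>?D. 1)"
      unfolding card by (intro sum_mono) force
    then show ?thesis
      by simp
  next
    case True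
    then obtain y where y: "y \<in> ?D" "card (fibre C y) \<ge> 2"
      by blast
    have "card (fibre C y') \<le> 1" if y': "y' \<in> ?D - {y}" for y'
    proof (rule ccontr)
      assume "\<not> ?thesis"
      moreover obtain w w' where "w \<in> fibre C y" "w' \<in> fibre C y'"
        using y y' by blast
      ultimately have "t * (fst y - fst y') > 0" "t * (fst y' - fst y) > 0"
        using multiple_fibre_extreme[OF C(1), of y y' w'] multiple_fibre_extreme[OF C(1), of y' y w] y y'
        by auto
      then show False
        by (simp add: algebra_simps)
    qed
    then have "(\<Sum>y\<in>?D - {y}. card (fibre C y)) \<le> (\<Sum>y\<in>?D - {y}. 1)"
      by (intro sum_mono)
    moreover have "card C = card (fibre C y) + (\<Sum>y\<in>?D - {y}. card (fibre C y))"
      unfolding card using finD y by (intro sum.remove) auto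
    moreover have "card (?D - {y}) + 1 = card ?D"
      using card.remove[OF finD y(1)] by simp
    ultimately show ?thesis
      using k[of y] y by simp
  qed
qed

text \<open>A triangle around \<open>v\<close> has strict orientations, so by
  \<open>ori_outer\<close> any representatives of its corner clusters surround the entire cluster at
  \<open>v\<close>.\<close>

lemma enclosed_inflate:
  assumes D: "D \<subseteq> Y" "\<And>y. y \<in> D \<Longrightarrow> fibre C y \<noteq> {}" and v: "v \<in> Y" "v \<in> enclosed D" "w \<in> Z v"
  shows "b v w \<in> enclosed C"
proof -
  obtain p q r where pqr: "p \<in> D" "q \<in> D" "r \<in> D" "ori p q v > 0" "ori q r v > 0" "ori r p v > 0"
    using v(2) unfolding enclosed_def by blast
  have "fibre C p \<noteq> {}" "fibre C q \<noteq> {}" "fibre C r \<noteq> {}"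
    using D(2) pqr(1-3) by simp_all
  then obtain z z' z'' where z: "z \<in> fibre C p" "z' \<in> fibre C q" "z'' \<in> fibre C r"
    unfolding ex_in_conv[symmetric] by (elim exE)
  have Y: "p \<in> Y" "q \<in> Y" "r \<in> Y"
    using pqr(1-3) by (simp_all add: subsetD[OF D(1)])
  have "ori (b p z) (b q z') (b v w) > 0" "ori (b q z') (b r z'') (b v w) > 0"
    "ori (b r z'') (b p z) (b v w) > 0"
    using pqr(4-6) Y z v unfolding fibre_def by (simp_all add: ori_outer)
  then show ?thesis
    using z unfolding enclosed_def fibre_def by blast
qed

lemma card_enclosed_ge:
  assumes D: "D \<subseteq> Y" "\<And>y. y \<in> D \<Longrightarrow> fibre C y \<noteq> {}" and k: "\<And>y. y \<in> Y \<Longrightarrow> card (Z y) = k"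
  shows "card (Y \<inter> enclosed D) * k \<le> card (whole \<inter> enclosed C)"
proof -
  let ?S = "SIGMA v:Y \<inter> enclosed D. Z v"
  have "card ?S = card (Y \<inter> enclosed D) * k"
    using finites k by (subst card_SigmaI) auto
  moreover have "card ?S \<le> card (whole \<inter> enclosed C)"
  proof (rule card_inj_on_le)
    show "inj_on (\<lambda>(y, z). b y z) ?S"
      using b_eq_iff unfolding inj_on_def by auto
    show "(\<lambda>(y, z). b y z) ` ?S \<subseteq> whole \<inter> enclosed C"
      using enclosed_inflate[OF D] unfolding whole_def by auto
    show "finite (whole \<inter> enclosed C)"
      using finites by simp
  qed
  ultimately show ?thesis
    by simp
qed

end

section \<open>Small sets without large cups and caps\<close>

text \<open>The bounds \<open>i + 1\<close> and \<open>j + 1\<close> are chosen so that the size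
  becomes \<open>(i + j) choose i\<close> and a single point is the base case. Steepness is carried
  along because these sets serve as clusters.\<close>

definition cup_cap_free :: "nat \<Rightarrow> nat \<Rightarrow> point set \<Rightarrow> bool" where
  "cup_cap_free i j S \<longleftrightarrow> general S \<and> steep S \<and>
     (\<forall>C\<subseteq>S. bends 1 C \<longrightarrow> card C \<le> i + 1) \<and> (\<forall>C\<subseteq>S. bends (- 1) C \<longrightarrow> card C \<le> j + 1)"

text \<open>The Erdos-Szekeres recursion as an inflation of two points, with \<open>A\<close> on the
  left and \<open>B\<close> on the right. A cup meeting \<open>B\<close> has at most one point in
  \<open>A\<close>, a cap meeting \<open>A\<close> at most one in \<open>B\<close>, and the sizes
  add up by Pascal's rule.\<close>

lemma cup_cap_free_exists: "\<exists>S. cup_cap_free i j S \<and> card S = (i + j) choose i"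
proof (induction "i + j" arbitrary: i j rule: less_induct)
  case less
  show ?case
  proof (cases "i = 0 \<or> j = 0")
    case True
    have "card C \<le> Suc n" if "C \<subseteq> {(0, 0)}" for C :: "point set" and n
      using card_mono[OF _ that] by simp
    then have "cup_cap_free i j {(0, 0)}"
      unfolding cup_cap_free_def general_def steep_def by simp
    then show ?thesis
      using True by (intro exI[of _ "{(0, 0)}"]) auto
  next
    case False
    then obtain i' j' where ij: "i = Suc i'" "j = Suc j'"
      by (metis not0_implies_Suc)
    obtain A B where A: "cup_cap_free i j' A" "card A = (i + j') choose i"
      and B: "cup_cap_free i' j B" "card B = (i' + j) choose i'"
      using less[of i j'] less[of i' j] ij by auto
    \<comment> \<open>The second base point is above the first, so the union of the two clusters is
      steep again.\<close>
    let ?u = "(0, 0) :: point" and ?v = "(1, 1) :: point"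
    define Z where "Z = (\<lambda>y. if y = ?u then A else B)"
    have gen: "general {?u, ?v}"
      unfolding general_def by auto
    have Zy: "general (Z y)" "steep (Z y)" for y
      using A(1) B(1) unfolding cup_cap_free_def Z_def by simp_all
    obtain b where "inflation {?u, ?v} Z b"
      using inflation_exists[of "{?u, ?v}" Z, OF gen Zy] by blast
    then interpret inflation "{?u, ?v}" Z b .
    have "steep whole"
      unfolding steep_def
    proof (intro ballI impI)
      fix p q assume pq: "p \<in> whole" "q \<in> whole" "fst p < fst q"
      then obtain y z y' z' where *: "p = b y z" "q = b y' z'" "y \<in> {?u, ?v}" "y' \<in> {?u, ?v}" "z \<in> Z y" "z' \<in> Z y'"
        unfolding whole_def by blast
      show "snd p < snd q"
      proof (cases "y = y'")
        case True
        then have zz: "z \<in> Z y" "z' \<in> Z y" "p = b y z" "q = b y z'"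
          using * by simp_all
        have "\<not> fst z' < fst z"
          using fst_inner[OF *(3) zz(2,1)] pq(3) zz by auto
        moreover have "fst z \<noteq> fst z'"
          using Zy(1)[of y] zz pq(3) unfolding general_def by (auto dest: inj_onD)
        ultimately have "snd z < snd z'"
          using Zy(2)[of y] zz unfolding steep_def by auto
        then show ?thesis
          using snd_inner[OF *(3) zz(1,2)] zz by simp
      next
        case False
        then have "y = ?u \<and> y' = ?v"
          using fst_outer[OF *(4,3,6,5)] pq(3) * by auto
        then show ?thesis
          using snd_outer[OF *(3-6)] * by simp
      qed
    qed
    moreover have "card whole = (i + j) choose i"
    proof -
      have "card whole = card A + card B"
        unfolding card_whole by (simp add: Z_def)
      then show ?thesis
        using A(2) B(2) ij by simp
    qed
    moreover
    have bound: "card C \<le> card (fibre C ?u) + card (fibre C ?v)" if "C \<subseteq> whole" for C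
      unfolding card_fibres[OF that] by simp
    have sub: "fibre C ?u \<subseteq> A" "fibre C ?v \<subseteq> B" for C
    proof -
      have "Z ?u = A" "Z ?v = B"
        by (simp_all add: Z_def)
      then show "fibre C ?u \<subseteq> A" "fibre C ?v \<subseteq> B"
        unfolding fibre_def by blast+
    qed
    have fibres: "card (fibre C ?u) \<le> i + 1" "card (fibre C ?v) \<le> i' + 1" if "bends 1 C" for C
      using A(1) B(1) sub[of C] bends_fibre[OF that, of ?u] bends_fibre[OF that, of ?v] unfolding cup_cap_free_def by simp_all
    have fibres': "card (fibre C ?u) \<le> j' + 1" "card (fibre C ?v) \<le> j + 1" if "bends (- 1) C" for C
      using A(1) B(1) sub[of C] bends_fibre[OF that, of ?u] bends_fibre[OF that, of ?v] unfolding cup_cap_free_def by simp_all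
    have "card C \<le> i + 1" if C: "C \<subseteq> whole" "bends 1 C" for C
    proof (cases "fibre C ?v = {}")
      case True
      then show ?thesis
        using bound[OF C(1)] fibres[OF C(2)] by simp
    next
      case False
      then obtain w where "w \<in> fibre C ?v"
        by blast
      then have "\<not> 2 \<le> card (fibre C ?u)"
        using multiple_fibre_extreme[OF C(2), of ?u ?v w] by auto
      then show ?thesis
        using bound[OF C(1)] fibres[OF C(2)] ij by linarith
    qed
    moreover have "card C \<le> j + 1" if C: "C \<subseteq> whole" "bends (- 1) C" for C
    proof (cases "fibre C ?u = {}")
      case True
      then show ?thesis
        using bound[OF C(1)] fibres'[OF C(2)] by simp
    next
      case False
      then obtain w where "w \<in> fibre C ?u"
        by blast
      then have "\<not> 2 \<le> card (fibre C ?v)"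
        using multiple_fibre_extreme[OF C(2), of ?v ?u w] by auto
      then show ?thesis
        using bound[OF C(1)] fibres'[OF C(2)] ij by linarith
    qed
    ultimately show ?thesis
      using general_whole unfolding cup_cap_free_def by (intro exI[of _ whole]) simp
  qed
qed

section \<open>Inflated Horton sets\<close>

lemma cc_eq:
  assumes "n \<ge> 2"
  shows "cc (int n) = 2 ^ ((n - 2) div 2) + 2 ^ ((n - 1) div 2) - real n - 1"
proof -
  have f: "\<lfloor>real_of_int (int n - 2) / 2\<rfloor> = int ((n - 2) div 2)"
    using assms by (simp add: floor_divide_of_int_eq[of "int n - 2" 2, simplified] of_nat_diff zdiv_int)
  have c: "\<lceil>real_of_int (int n - 2) / 2\<rceil> = int ((n - 1) div 2)"
  proof (rule ceiling_unique)
    define q where "q = (n - 1) div 2"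
    have "n = 2 * q + 1 \<or> n = 2 * q + 2"
      using assms unfolding q_def by presburger
    then have "real n = 2 * real q + 1 \<or> real n = 2 * real q + 2"
      by auto
    then show "real_of_int (int ((n - 1) div 2)) - 1 < real_of_int (int n - 2) / 2"
      "real_of_int (int n - 2) / 2 \<le> real_of_int (int ((n - 1) div 2))"
      unfolding q_def[symmetric] by auto
  qed
  show ?thesis
    unfolding cc_def f c by (simp add: power_int_def)
qed

text \<open>For \<open>n = 0\<close> and \<open>n = 1\<close> negative exponents occur and the
  values are \<open>0\<close> and \<open>- 1 / 2\<close>. Excluding them makes the natural-number
  subtractions in \<open>cc_eq\<close> harmless.\<close>

lemma cc_pos_ge_2:
  assumes "cc (int n) > 0"
  shows "n \<ge> 2"
proof (rule ccontr)
  assume "\<not> ?thesis"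
  then consider "n = 0" | "n = 1" by linarith
  then show False
  proof cases
    case 1
    have "\<lfloor>real_of_int (int 0 - 2) / 2\<rfloor> = - 1"
      by (rule floor_unique) simp_all
    moreover have "\<lceil>real_of_int (int 0 - 2) / 2\<rceil> = - 1"
      by (rule ceiling_unique) simp_all
    ultimately have "cc (int 0) = 0"
      unfolding cc_def by (simp only:) (simp add: power_int_def)
    then show ?thesis
      using assms 1 by simp
  next
    case 2
    have "\<lfloor>real_of_int (int 1 - 2) / 2\<rfloor> = - 1"
      by (rule floor_unique) simp_all
    moreover have "\<lceil>real_of_int (int 1 - 2) / 2\<rceil> = 0"
      by (rule ceiling_unique) simp_all
    ultimately have "cc (int 1) = - 1 / 2"
      unfolding cc_def by (simp only:) (simp add: power_int_def)
    then show ?thesis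
      using assms 2 by simp
  qed
qed

text \<open>Among \<open>n + k\<close> points at most \<open>k\<close> are repetitions within a
  cluster, so at least \<open>n\<close> clusters are met. Their base points bend in the same way,
  and each base point they enclose brings its whole copy of \<open>Z\<close> inside.\<close>

lemma inflated_horton_enclosed:
  assumes "inflation Y (\<lambda>_. Z) b" "horton Y" "t = 1 \<or> t = - 1"
    and free: "\<And>C. C \<subseteq> Z \<Longrightarrow> bends t C \<Longrightarrow> card C \<le> k + 1"
    and n: "cc (int n) > 0"
    and C: "bends t C" "C \<subseteq> inflation.whole Y (\<lambda>_. Z) b" "card C = n + k"
  shows "(cc (int n) + 1) * real (card Z) \<le>
    real (card {p \<in> inflation.whole Y (\<lambda>_. Z) b. p \<in> interior (convex hull C)})"
proof -
  interpret inflation Y "\<lambda>_. Z" b by fact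
  let ?E = "{y\<in>Y. fibre C y \<noteq> {}}"
  have "card (fibre C y) \<le> k + 1" if "y \<in> Y" for y
  proof (rule free)
    show "fibre C y \<subseteq> Z"
      unfolding fibre_def by blast
  qed (rule bends_fibre[OF C(1) that])
  then have "n \<le> card ?E"
    using card_bends_le[OF C(1,2), of k] C(3) by simp
  \<comment> \<open>Cutting down to exactly \<open>n\<close> clusters makes the bound come out as
    \<open>cc (int n) + 1\<close>.\<close>
  then obtain D where D: "D \<subseteq> ?E" "card D = n"
    by (meson obtain_subset_with_card_n)
  note n2 = cc_pos_ge_2[OF n]
  have "2 ^ ((n - 2) div 2) + 2 ^ ((n - 1) div 2) \<le> card (Y \<inter> enclosed D) + n"
  proof -
    have sub: "D \<subseteq> Y" and ne: "\<And>y. y \<in> D \<Longrightarrow> fibre C y \<noteq> {}"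
      using D(1) by blast+
    show ?thesis
      using horton_enclosed[OF assms(2,3) sub bends_outer[OF C(1) sub ne]] D(2) n2 by simp
  qed
  then have "real (2 ^ ((n - 2) div 2) + 2 ^ ((n - 1) div 2)) \<le> real (card (Y \<inter> enclosed D) + n)"
    by (simp only: of_nat_le_iff)
  then have "cc (int n) + 1 \<le> real (card (Y \<inter> enclosed D))"
    unfolding cc_eq[OF n2] by simp
  then have "(cc (int n) + 1) * real (card Z) \<le> real (card (Y \<inter> enclosed D) * card Z)"
    by (simp add: mult_right_mono)
  also have "card (Y \<inter> enclosed D) * card Z \<le> card (whole \<inter> enclosed C)"
    using D by (intro card_enclosed_ge) auto
  also have "card (whole \<inter> enclosed C) \<le> card {p \<in> whole. p \<in> interior (convex hull C)}"
    using enclosed_subset_interior[of C] finites(4) by (intro card_mono) auto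
  finally show ?thesis
    by simp
qed

theorem mainTheorem5:
  fixes l m l0 m0 :: nat and l1 m1 :: real
  assumes "cc (int l0) > 0" and "cc (int m0) > 0"
    and "l \<ge> 5" and "m \<ge> 5" and "l \<ge> l0" and "m \<ge> m0"
    and "l1 = cc (int l0) * real ((l + m - l0 - m0) choose (l - l0)) - 1"
    and "m1 = cc (int m0) * real ((l + m - l0 - m0) choose (m - m0)) - 1"
  shows "\<forall>N::nat. N > 0 \<longrightarrow> (\<exists>X. admissible X \<and> card X \<ge> N \<and>
           \<not> (\<exists>ps. set ps \<subseteq> X \<and> is_cup l ps \<and> real (inside_count X ps) \<le> l1) \<and>
           \<not> (\<exists>ps. set ps \<subseteq> X \<and> is_cap m ps \<and> real (inside_count X ps) \<le> m1))"
proof (intro allI impI)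
  fix N :: nat
  let ?i = "l - l0" and ?j = "m - m0"
  have sum: "l + m - l0 - m0 = ?i + ?j"
    using assms by simp
  obtain Z where free: "cup_cap_free ?i ?j Z" "card Z = (?i + ?j) choose ?i"
    using cup_cap_free_exists by blast
  obtain Y where H: "horton Y" "snd ` Y = real ` {..<2 ^ N}"
    using horton_exists by blast
  have "card Y = card (real ` {..<2 ^ N :: nat})"
    using card_image[OF horton_inj_snd[OF H(1)]] H(2) by simp
  also have "\<dots> = 2 ^ N"
    by (subst card_image) auto
  finally have cardY: "card Y = 2 ^ N" .
  obtain b where b: "inflation Y (\<lambda>_. Z) b"
    using inflation_exists[OF horton_general[OF H(1)], of "\<lambda>_. Z"] free(1) unfolding cup_cap_free_def by blast
  interpret inflation Y "\<lambda>_. Z" b by (rule b)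
  have pos: "card Z \<ge> 1"
    using free(2) by (simp add: Suc_le_eq)
  have "N \<le> card whole"
  proof -
    have "N \<le> card Y * 1"
      using cardY less_exp[of N] by simp
    also have "\<dots> \<le> card Y * card Z"
      using pos by (rule mult_le_mono2)
    finally show ?thesis
      unfolding card_whole by simp
  qed
  moreover have "real (inside_count whole ps) > l1" if ps: "set ps \<subseteq> whole" "is_cup l ps" for ps
  proof -
    have "(cc (int l0) + 1) * real (card Z) \<le> real (inside_count whole ps)"
      unfolding inside_count_def
      using inflated_horton_enclosed[OF b H(1), of 1 ?i l0 "set ps"] free(1) is_cup_bends[OF ps(2)] ps(1) assms(1,5)
      unfolding cup_cap_free_def by simp
    \<comment> \<open>The surplus \<open>card Z\<close> in the count exceeds the \<open>- 1\<close>
      in \<open>l1\<close>, so the inequality is strict.\<close>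
    then show ?thesis
      using assms(7) pos free(2) unfolding sum by (simp add: algebra_simps)
  qed
  moreover have "real (inside_count whole ps) > m1" if ps: "set ps \<subseteq> whole" "is_cap m ps" for ps
  proof -
    have "(cc (int m0) + 1) * real (card Z) \<le> real (inside_count whole ps)"
      unfolding inside_count_def
      using inflated_horton_enclosed[OF b H(1), of "- 1" ?j m0 "set ps"] free(1) is_cap_bends[OF ps(2)] ps(1) assms(2,6)
      unfolding cup_cap_free_def by simp
    \<comment> \<open>The two thresholds use complementary binomial coefficients, so the same
      \<open>Z\<close> serves cups and caps.\<close>
    moreover have "(?i + ?j) choose ?j = card Z"
      unfolding free(2) using binomial_symmetric[of ?j "?i + ?j"] by simp
    ultimately show ?thesis
      using assms(8) pos unfolding sum by (simp add: algebra_simps)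
  qed
  ultimately show "\<exists>X. admissible X \<and> card X \<ge> N \<and>
           \<not> (\<exists>ps. set ps \<subseteq> X \<and> is_cup l ps \<and> real (inside_count X ps) \<le> l1) \<and>
           \<not> (\<exists>ps. set ps \<subseteq> X \<and> is_cap m ps \<and> real (inside_count X ps) \<le> m1)"
    using general_admissible[OF general_whole] by (intro exI[of _ whole] conjI) (auto simp: not_le)
qed

end
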